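(* Let $k\ge 3$ be an integer and let $\gamma\subset\mathbb{R}^2$ be a $C^2$-smooth, planar, strictly convex closed curve which is invariant under a linear map of $\mathbb{R}^2$ of order $k$. If the Symplectic billiard map inside $\gamma$ has a rotational invariant curve of $k$-periodic orbits, then $\gamma$ is an ellipse.
   Context: A linear map $A$ has order $k$ if $k$ is the least positive integer with $A^k=I$. $[u,v]$ denotes the determinant of the vectors $u,v\in\mathbb{R}^2$. Symplectic billiard map: three points of $\gamma$ are consecutive points $\gamma(t_1),\gamma(t_2),\gamma(t_3)$ of a Symplectic billiard orbit if and only if the tangent to $\gamma$ at $\gamma(t_2)$ is parallel to the segment connecting $\gamma(t_1)$ and $\gamma(t_3)$. For a positively oriented parametrization $\gamma(t)$, this is the twist map with generating function $S(t,t_1)=[\gamma(t),\gamma(t_1)]$, i.e. $T(t,s)=(t_1,s_1)$ if and only if $s=-[\dot\gamma(t),\gamma(t_1)]$ and $s_1=[\gamma(t),\dot\gamma(t_1)]$. The phase space is the cylinder of ordered pairs $(t,t_1)$ for which the twist condition holds, namely $[\dot\gamma(t),\dot\gamma(t_1)]>0$; it has coordinates $(t,s)$. A rotational invariant curve is a simple closed curve in the phase cylinder, homotopically non-trivial (winding once around the cylinder), that is mapped to itself by $T$. It is a rotational invariant curve of $k$-periodic orbits if all its points are periodic for $T$ with (minimal) period $k$; its rotation number is then of the form $r/k$ with $r$ coprime to $k$. *)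

theory Defs
  imports "HOL-Analysis.Analysis"
begin

abbreviation det2 :: "real^2 \<Rightarrow> real^2 \<Rightarrow> real"
  where "det2 u v \<equiv> det (vector [u, v] :: real^2^2)"

abbreviation velocity :: "(real \<Rightarrow> real^2) \<Rightarrow> real \<Rightarrow> real^2"
  where "velocity \<gamma> t \<equiv> vector_derivative \<gamma> (at t)"

definition map_order :: "('a \<Rightarrow> 'a) \<Rightarrow> nat \<Rightarrow> bool"
  where "map_order A k \<longleftrightarrow> 0 < k \<and> A ^^ k = id \<and> (\<forall>j. 0 < j \<and> j < k \<longrightarrow> A ^^ j \<noteq> id)"

definition ellipse :: "(real^2) set \<Rightarrow> bool"
  where "ellipse E \<longleftrightarrow> (\<exists>(f :: real^2 \<Rightarrow> real^2) c. linear f \<and> bij f \<and> E = (\<lambda>x. c + f x) ` sphere 0 1)"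


text \<open>A closed curve is parametrized by an \<open>L\<close>-periodic map on the real line; a parameter value
  is meant modulo \<open>L\<close>.\<close>

definition simple_closed_C2_curve :: "(real \<Rightarrow> real^2) \<Rightarrow> real \<Rightarrow> bool"
  where "simple_closed_C2_curve \<gamma> L \<longleftrightarrow>
     0 < L \<and> (\<forall>t. \<gamma> (t + L) = \<gamma> t) \<and> inj_on \<gamma> {0..<L} \<and>
     \<gamma> C1_differentiable_on UNIV \<and> velocity \<gamma> C1_differentiable_on UNIV \<and>
     (\<forall>t. velocity \<gamma> t \<noteq> 0)"

definition strictly_convex_curve :: "(real^2) set \<Rightarrow> bool"
  where "strictly_convex_curve C \<longleftrightarrow>
     C = frontier (convex hull C) \<and>
     (\<forall>x\<in>C. \<forall>y\<in>C. x \<noteq> y \<longrightarrow> open_segment x y \<subseteq> interior (convex hull C))"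

text \<open>The enclosed region lies to the left of the direction of motion.\<close>

definition positively_oriented :: "(real \<Rightarrow> real^2) \<Rightarrow> bool"
  where "positively_oriented \<gamma> \<longleftrightarrow>
     (\<forall>t. \<forall>x \<in> interior (convex hull range \<gamma>). 0 < det2 (velocity \<gamma> t) (x - \<gamma> t))"


text \<open>The phase cylinder has coordinates \<open>(t, s)\<close> with \<open>t\<close> modulo \<open>L\<close>. All objects on it are
  described on the universal cover, where \<open>t\<close> is a real number: subsets of the cylinder by their
  full preimages, and equality of points of the cylinder by \<open>same_point\<close>.\<close>

definition same_point :: "real \<Rightarrow> real \<times> real \<Rightarrow> real \<times> real \<Rightarrow> bool"
  where "same_point L x y \<longleftrightarrow> (\<exists>n::int. x = y + (of_int n * L, 0))"

definition phase_space :: "(real \<Rightarrow> real^2) \<Rightarrow> (real \<times> real) set"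
  where "phase_space \<gamma> =
     {(t, - det2 (velocity \<gamma> t) (\<gamma> t1)) |t t1. 0 < det2 (velocity \<gamma> t) (velocity \<gamma> t1)}"

text \<open>The relation generated by \<open>S(t, t1) = det2 (\<gamma> t) (\<gamma> t1)\<close>, that is,
  \<open>s = - \<partial>S/\<partial>t\<close> and \<open>s1 = \<partial>S/\<partial>t1\<close>, under the twist condition \<open>\<partial>\<^sup>2S/\<partial>t\<partial>t1 > 0\<close>.\<close>

definition billiard_step :: "(real \<Rightarrow> real^2) \<Rightarrow> real \<times> real \<Rightarrow> real \<times> real \<Rightarrow> bool"
  where "billiard_step \<gamma> x y \<longleftrightarrow>
     (case (x, y) of ((t, s), (t1, s1)) \<Rightarrow>
        0 < det2 (velocity \<gamma> t) (velocity \<gamma> t1) \<and>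
        s = - det2 (velocity \<gamma> t) (\<gamma> t1) \<and>
        s1 = det2 (\<gamma> t) (velocity \<gamma> t1))"

lemma billiard_step_tangent_parallel:
  assumes "billiard_step \<gamma> (t0, s0) (t1, s1)" and "billiard_step \<gamma> (t1, s1) (t2, s2)"
  shows "det2 (velocity \<gamma> t1) (\<gamma> t2 - \<gamma> t0) = 0"
  using assms by (simp add: billiard_step_def det_2 algebra_simps)

text \<open>\<open>billiard_step\<close> determines \<open>t1\<close> only modulo \<open>L\<close>; the condition \<open>t < t1 < t + L\<close> selects
  one representative, which makes the following function the lift to the universal cover
  of the symplectic billiard map.\<close>

definition billiard_map :: "(real \<Rightarrow> real^2) \<Rightarrow> real \<Rightarrow> real \<times> real \<Rightarrow> real \<times> real"
  where "billiard_map \<gamma> L x =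
     (THE y. fst x < fst y \<and> fst y < fst x + L \<and> billiard_step \<gamma> x y)"

definition minimal_period :: "(real \<Rightarrow> real^2) \<Rightarrow> real \<Rightarrow> real \<times> real \<Rightarrow> nat \<Rightarrow> bool"
  where "minimal_period \<gamma> L x k \<longleftrightarrow>
     0 < k \<and> same_point L ((billiard_map \<gamma> L ^^ k) x) x \<and>
     (\<forall>j. 0 < j \<and> j < k \<longrightarrow> \<not> same_point L ((billiard_map \<gamma> L ^^ j) x) x)"

text \<open>A closed curve on the cylinder that winds once around it, traversed in the direction of
  increasing \<open>t\<close>, lifts to a map \<open>c\<close> with \<open>c (u + 1) = c u + (L, 0)\<close>. Given this equation, \<open>c\<close> is
  injective on the whole real line exactly if the closed curve is simple. The range of \<open>c\<close> is the
  full preimage of the closed curve.\<close>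

definition rotational_curve :: "real \<Rightarrow> (real \<times> real) set \<Rightarrow> bool"
  where "rotational_curve L C \<longleftrightarrow>
     (\<exists>c :: real \<Rightarrow> real \<times> real. continuous_on UNIV c \<and> inj c \<and>
        (\<forall>u. c (u + 1) = c u + (L, 0)) \<and> C = range c)"

definition rotational_invariant_curve ::
    "(real \<Rightarrow> real^2) \<Rightarrow> real \<Rightarrow> (real \<times> real) set \<Rightarrow> bool"
  where "rotational_invariant_curve \<gamma> L C \<longleftrightarrow>
     rotational_curve L C \<and> C \<subseteq> phase_space \<gamma> \<and> billiard_map \<gamma> L ` C = C"

end

theory Submission
  imports Defs
begin

text \<open>
  The idea is that the billiard map on the invariant curve must coincide with a power of the
  linear symmetry.  Suppose this is known: for some \<open>B = A\<^sup>j\<close>, the orbit of \<open>p\<close> is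
  \<open>\<dots>, B\<^sup>-\<^sup>1 p, p, B p, \<dots>\<close>.  By the reflection law the tangent at \<open>p\<close> is parallel to
  \<open>B p - B\<^sup>-\<^sup>1 p\<close>, and for an inner product invariant under \<open>A\<close> this vector is orthogonal to \<open>p\<close>.
  So the invariant quadratic form is constant along the curve, which is therefore contained in
  an ellipse (\<open>curve_in_ellipse\<close>), and fills it because the origin is an interior point
  (\<open>range_is_ellipse\<close>).

  To compare dynamics and symmetry, both are lifted to increasing maps of the line.  Since all
  points of the invariant curve have period \<open>k\<close>, the dynamics on it is conjugate to the translation
  by \<open>\<theta> = n / k\<close>, with \<open>n\<close> coprime to \<open>k\<close> (\<open>periodic_curve_translation\<close>).  Let \<open>X\<close> be the impact
  parameter along the curve in this coordinate.  The symmetry, written in the same coordinate, will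
  commute with the translation by \<open>\<theta>\<close>, hence with that by \<open>1 / k\<close>, and its \<open>k\<close>-th power is
  an integer translation; so it is the translation by some \<open>m / k\<close>
  (\<open>symmetry_is_translation\<close>).  As \<open>A\<close> has order exactly \<open>k\<close>, the number \<open>m\<close> is coprime to \<open>k\<close> and the
  dynamics is a power of the symmetry (\<open>dynamics_is_symmetry\<close>).

  What remains is to see that the symmetry maps the invariant curve to itself and commutes with the
  dynamics.  This rests on the twist property (\<open>consec_twist\<close>): if two orbits share an impact
  and neither the previous nor the next impact of the second lies behind that of the first, then the
  orbits coincide.  So orbits cannot touch from one side.  Sliding the invariant curve against its
  own translates, this shows that it is a graph over the table (\<open>X_strict_mono\<close>), which is a case
  of Birkhoff's theorem; its orbits thus foliate the line.  Sliding the symmetric image of an orbit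
  against this foliation shows that the image is again an orbit of the curve, with the same phase
  shift at all its points (\<open>symmetry_commutes\<close>).
\<close>

section \<open>Monotone maps of the line that commute with a translation\<close>

lemma shift_of_int:
  fixes f :: "real \<Rightarrow> 'a::real_vector"
  assumes "\<And>u. f (u + p) = f u + q"
  shows "f (u + of_int j * p) = f u + of_int j *\<^sub>R q"
proof -
  have nat: "f (v + of_nat i * p) = f v + of_nat i *\<^sub>R q" for v i
  proof (induction i)
    case (Suc i)
    have "f (v + of_nat (Suc i) * p) = f ((v + of_nat i * p) + p)" by (simp add: algebra_simps)
    also have "\<dots> = f v + of_nat i *\<^sub>R q + q" using assms Suc by simp
    finally show ?case by (simp add: algebra_simps)
  qed simp
  show ?thesis
  proof (cases "j \<ge> 0")
    case True
    then show ?thesis using nat[of u "nat j"] by simp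
  next
    case False
    define i where "i = nat (- j)"
    then have j: "j = - int i" using False by simp
    show ?thesis unfolding j using nat[of "u + of_int j * p" i] by (simp add: j)
  qed
qed

lemma shift_near_linear:
  fixes X :: "real \<Rightarrow> real"
  assumes "continuous_on UNIV X" and shift: "\<And>u. X (u + 1) = X u + L"
  obtains M where "M > 0" and "\<And>v. \<bar>X v - L * v\<bar> \<le> M"
proof -
  have "continuous_on {0..1} (\<lambda>v. X v - L * v)"
    by (intro continuous_intros continuous_on_subset[OF assms(1)]) auto
  then have "bounded ((\<lambda>v. X v - L * v) ` {0..1})"
    by (intro compact_imp_bounded compact_continuous_image) auto
  then obtain M where M: "M > 0" "\<And>v. v \<in> {0..1} \<Longrightarrow> \<bar>X v - L * v\<bar> \<le> M"
    unfolding bounded_pos by auto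
  have "\<bar>X v - L * v\<bar> \<le> M" for v
  proof -
    have "X v = X (frac v) + of_int \<lfloor>v\<rfloor> * L"
      using shift_of_int[of X 1 L, OF shift, of "frac v" "\<lfloor>v\<rfloor>"] by (simp add: frac_def)
    then have "X v - L * v = X (frac v) - L * frac v" by (simp add: frac_def algebra_simps)
    then show ?thesis using M(2)[of "frac v"] by (simp add: less_imp_le[OF frac_lt_1])
  qed
  with M(1) show thesis by (rule that)
qed

lemma shift_surj:
  fixes X :: "real \<Rightarrow> real"
  assumes cont: "continuous_on UNIV X" and shift: "\<And>u. X (u + 1) = X u + L" and "L > 0"
  shows "surj X"
proof -
  obtain M where M: "\<And>v. \<bar>X v - L * v\<bar> \<le> M"
    using shift_near_linear[of X L] cont shift by metis
  have "\<exists>u. X u = y" for y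
  proof -
    define a b where "a = (y - M) / L" and "b = (y + M) / L"
    have "M \<ge> 0" using M[of 0] by linarith
    then have "a \<le> b" using \<open>L > 0\<close> by (simp add: a_def b_def divide_right_mono)
    moreover have "X a \<le> y" using M[of a] \<open>L > 0\<close> by (simp add: a_def)
    moreover have "y \<le> X b" using M[of b] \<open>L > 0\<close> by (simp add: b_def)
    ultimately show ?thesis using IVT'[of X a y b] continuous_on_subset[OF cont] by blast
  qed
  then show ?thesis unfolding surj_def by metis
qed

text \<open>A circle homeomorphism whose \<open>k\<close>-th power is the identity is conjugate to a rotation: in the
  coordinate given by the average of the first \<open>k\<close> iterates, its lift \<open>g\<close> is a translation.\<close>

lemma conjugate_to_translation:
  fixes g :: "real \<Rightarrow> real"
  assumes cont: "continuous_on UNIV g" and shift: "\<And>u. g (u + 1) = g u + 1"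
    and "k > 0" and period: "\<And>u. (g ^^ k) u - u \<in> \<int>"
  obtains h and n :: int
  where "strict_mono h" and "continuous_on UNIV h" and "surj h" and "\<And>u. h (u + 1) = h u + 1"
    and "\<And>u. h (g u) = h u + of_int n / k"
proof -
  have cont_pow: "continuous_on UNIV (g ^^ i)" for i
  proof (induction i)
    case (Suc i)
    then show ?case
      using continuous_on_compose[of UNIV "g ^^ i" g] continuous_on_subset[OF cont] by simp
  qed (simp add: id_def)
  have shift_pow: "(g ^^ i) (u + 1) = (g ^^ i) u + 1" for i u
    by (induction i) (auto simp: shift)
  \<comment> \<open>A continuous function with integer values on a connected set is constant.\<close>
  have "(\<lambda>u. (g ^^ k) u - u) constant_on UNIV"
  proof (rule continuous_discrete_range_constant)
    show "connected (UNIV::real set)" by simp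
    show "continuous_on UNIV (\<lambda>u. (g ^^ k) u - u)" by (intro continuous_intros cont_pow)
    fix u
    have "1 \<le> norm ((g ^^ k) y - y - ((g ^^ k) u - u))"
      if "(g ^^ k) y - y \<noteq> (g ^^ k) u - u" for y
    proof -
      obtain p q where pq: "(g ^^ k) y - y = of_int p" "(g ^^ k) u - u = of_int q"
        using period by (metis Ints_cases)
      then have "1 \<le> \<bar>p - q\<bar>" using that by auto
      then show ?thesis using pq by (metis of_int_1_le_iff of_int_abs of_int_diff real_norm_def)
    qed
    then show "\<exists>e>0. \<forall>y. y \<in> UNIV \<and> (g ^^ k) y - y \<noteq> (g ^^ k) u - u \<longrightarrow>
        e \<le> norm ((g ^^ k) y - y - ((g ^^ k) u - u))"
      by (intro exI[of _ 1]) auto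
  qed
  then obtain d where d: "\<And>u. (g ^^ k) u - u = d" unfolding constant_on_def by auto
  then obtain n where n: "\<And>u. (g ^^ k) u = u + of_int n"
  proof -
    assume *: "\<And>n. (\<And>u. (g ^^ k) u = u + of_int n) \<Longrightarrow> thesis"
    obtain n where "d = of_int n" using period[of 0] d Ints_cases by metis
    with d have "(g ^^ k) u = u + of_int n" for u by (metis add.commute diff_add_cancel)
    then show thesis by (rule *)
  qed
  have "inj g"
  proof (rule injI)
    fix u v assume "g u = g v"
    then have "(g ^^ k) u = (g ^^ k) v"
      using \<open>k > 0\<close> by (cases k) (auto simp: funpow_Suc_right simp del: funpow.simps)
    then show "u = v" using n by simp
  qed
  then have mono: "strict_mono g"
  proof -
    have "strict_mono_on UNIV g \<or> strict_antimono_on UNIV g"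
      using \<open>inj g\<close> cont injective_eq_monotone_map[of UNIV g] by simp
    then show ?thesis
    proof
      assume "strict_antimono_on UNIV g"
      \<comment> \<open>impossible, since \<open>g\<close> has degree one\<close>
      then have "g 1 < g 0" unfolding monotone_on_def by auto
      then show ?thesis using shift[of 0] by simp
    qed
  qed
  have mono_pow: "strict_mono (g ^^ i)" for i
  proof (induction i)
    case (Suc i)
    then show ?case using mono unfolding strict_mono_def funpow.simps comp_def by blast
  qed (simp add: strict_mono_def)
  define h where "h u = (\<Sum>i<k. (g ^^ i) u) / k" for u
  have h_mono: "strict_mono h"
  proof (rule strict_monoI)
    fix u v :: real assume "u < v"
    then have "(\<Sum>i<k. (g ^^ i) u) < (\<Sum>i<k. (g ^^ i) v)"
      using \<open>k > 0\<close> mono_pow by (intro sum_strict_mono) (auto dest: strict_monoD)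
    then show "h u < h v" using \<open>k > 0\<close> by (simp add: h_def divide_strict_right_mono)
  qed
  have h_cont: "continuous_on UNIV h"
    unfolding h_def using \<open>k > 0\<close> by (intro continuous_intros cont_pow) auto
  have h_shift: "h (u + 1) = h u + 1" for u
    unfolding h_def using \<open>k > 0\<close> by (simp add: shift_pow sum.distrib add_divide_distrib)
  have h_g: "h (g u) = h u + of_int n / k" for u
  proof -
    have "(\<Sum>i<k. (g ^^ i) (g u)) = (\<Sum>i<k. (g ^^ Suc i) u)"
      by (simp add: funpow_swap1)
    also have "\<dots> = (\<Sum>i<k. (g ^^ i) u) + (g ^^ k) u - u"
      using sum.lessThan_Suc_shift[of "\<lambda>i. (g ^^ i) u" k] sum.lessThan_Suc[of "\<lambda>i. (g ^^ i) u" k]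
      by simp
    finally show ?thesis unfolding h_def n by (simp add: add_divide_distrib)
  qed
  show thesis using that[of h n] h_mono h_cont shift_surj[OF h_cont h_shift] h_shift h_g by simp
qed

text \<open>If \<open>\<phi>\<close> moves \<open>u\<close> by more than \<open>r\<close> and commutes with the translation by \<open>r\<close>, then by monotonicity
  \<open>\<phi>\<^sup>k\<close> moves \<open>u\<close> by more than \<open>k * r\<close>, and likewise for less.  So at each point \<open>\<phi>\<close> is the
  translation by \<open>1 / k\<close> times an integer, and monotonicity again does not let the integer
  jump.\<close>

lemma root_of_translation:
  fixes \<phi> :: "real \<Rightarrow> real"
  assumes mono: "strict_mono \<phi>" and "k > 0"
    and commute: "\<And>u. \<phi> (u + 1 / k) = \<phi> u + 1 / k"
    and pow: "\<And>u. (\<phi> ^^ k) u - u \<in> \<int>"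
  obtains m :: int where "\<And>u. \<phi> u = u + of_int m / k"
proof -
  have "\<exists>m::int. \<phi> u = u + of_int m / k" for u
  proof -
    obtain m :: int where m: "(\<phi> ^^ k) u = u + of_int m"
      using pow[of u] by (metis Ints_cases add.commute diff_add_cancel)
    define r where "r = of_int m / real k"
    have tr: "\<phi> (v + of_nat i * r) = \<phi> v + of_nat i * r" for v i
      using shift_of_int[of \<phi> "1 / k" "1 / k", OF commute, of v "int i * m"] by (simp add: r_def)
    have "(\<phi> ^^ Suc i) u > u + of_nat (Suc i) * r" if "\<phi> u > u + r" for i
    proof (induction i)
      case (Suc i)
      have "\<phi> (u + of_nat (Suc i) * r) < \<phi> ((\<phi> ^^ Suc i) u)" using Suc mono by (simp add: strict_mono_def)
      then show ?case using that tr[of u "Suc i"] by (simp add: algebra_simps)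
    qed (use that in simp)
    moreover have "(\<phi> ^^ Suc i) u < u + of_nat (Suc i) * r" if "\<phi> u < u + r" for i
    proof (induction i)
      case (Suc i)
      have "\<phi> (u + of_nat (Suc i) * r) > \<phi> ((\<phi> ^^ Suc i) u)" using Suc mono by (simp add: strict_mono_def)
      then show ?case using that tr[of u "Suc i"] by (simp add: algebra_simps)
    qed (use that in simp)
    moreover have "(\<phi> ^^ k) u = u + of_nat k * r" using m \<open>k > 0\<close> by (simp add: r_def)
    ultimately have "\<phi> u = u + r"
      using \<open>k > 0\<close> by (cases k) (metis less_irrefl linorder_neqE, metis less_irrefl linorder_neqE)
    then show ?thesis unfolding r_def by blast
  qed
  then obtain m :: "real \<Rightarrow> int" where m: "\<And>u. \<phi> u = u + of_int (m u) / k" by metis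
  have step: "m v = m u" if "u < v" "v < u + 1 / k" for u v
  proof -
    have "\<phi> u < \<phi> v" "\<phi> v < \<phi> u + 1 / k"
      using strict_monoD[OF mono that(1)] strict_monoD[OF mono that(2)] commute[of u] by simp_all
    then have a: "u - v < (of_int (m v) - of_int (m u)) / k" "(of_int (m v) - of_int (m u)) / k < 1 / k + (u - v)"
      using m by (auto simp: algebra_simps diff_divide_distrib)
    have "- 1 / k < (of_int (m v) - of_int (m u)) / k" using a(1) that by simp
    moreover have "(of_int (m v) - of_int (m u)) / k < 1 / k" using a(2) that by simp
    ultimately have "- 1 < (of_int (m v) - of_int (m u) :: real)" "(of_int (m v) - of_int (m u) :: real) < 1"
      using \<open>k > 0\<close> divide_less_cancel[of "- 1" "real k" "of_int (m v) - of_int (m u)"]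
      by (simp_all add: divide_less_cancel)
    then show ?thesis by linarith
  qed
  have "m u = m 0" for u
  proof -
    define v where "v = u + of_int (- \<lfloor>u * k\<rfloor>) * (1 / k)"
    have "\<phi> v = \<phi> u + of_int (- \<lfloor>u * k\<rfloor>) * (1 / k)"
      unfolding v_def using shift_of_int[of \<phi> "1 / k" "1 / k", OF commute, of u "- \<lfloor>u * k\<rfloor>"] by simp
    then have "m v = m u" using m[of v] m[of u] \<open>k > 0\<close> by (simp add: v_def)
    have "v = frac (u * k) / k" using \<open>k > 0\<close> by (simp add: v_def frac_def field_simps)
    then have "0 \<le> v" "v < 1 / k" using \<open>k > 0\<close> by (simp_all add: divide_strict_right_mono frac_lt_1)
    then have "m v = m 0" using step[of 0 v] by (cases "v = 0") auto
    with \<open>m v = m u\<close> show ?thesis by simp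
  qed
  then have "\<phi> u = u + of_int (m 0) / k" for u using m[of u] by simp
  then show thesis by (rule that)
qed

section \<open>Invariant circles of periodic orbits of a twist relation\<close>

text \<open>The relation \<open>consec\<close> abstracts the consecutive impact parameters of the billiard, and \<open>X\<close> is
  the first coordinate along an invariant curve whose parameter is chosen such that the dynamics
  translates it by \<open>\<theta>\<close>.  The last assumption states that the curve is simple: a point of the
  phase cylinder is determined by two successive impacts.\<close>

locale periodic_invariant_circle =
  fixes consec :: "real \<Rightarrow> real \<Rightarrow> real \<Rightarrow> bool" and L \<theta> :: real and X :: "real \<Rightarrow> real"
  assumes L_pos: "L > 0"
    and cont: "continuous_on UNIV X"
    and shift: "X (u + 1) = X u + L"
    and orbit: "consec (X (u - \<theta>)) (X u) (X (u + \<theta>))"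
    and twist: "consec x0 x1 x2 \<Longrightarrow> consec y0 x1 y2 \<Longrightarrow> x0 \<le> y0 \<Longrightarrow> x2 \<le> y2 \<Longrightarrow> x0 = y0 \<and> x2 = y2"
    and determined: "X u = X v \<Longrightarrow> X (u + \<theta>) = X (v + \<theta>) \<Longrightarrow> u = v"
begin

lemma shift_int: "X (u + of_int j) = X u + of_int j * L"
  using shift_of_int[of X 1 L, OF shift] by simp

text \<open>Graph property (Birkhoff's theorem for circles of periodic orbits).  If \<open>X\<close> were not
  increasing, there would be a largest \<open>a > 0\<close> for which \<open>X (u + a) \<le> X u\<close> happens for
  some \<open>u\<close>.  The curve and its translate by this \<open>a\<close> touch without crossing at that \<open>u\<close>, so the
  twist condition makes the two orbits through the point of contact equal.\<close>

lemma X_strict_mono: "strict_mono X"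
proof (rule ccontr)
  assume "\<not> strict_mono X"
  then obtain w0 w1 where w: "w0 < w1" "X w1 \<le> X w0" unfolding strict_mono_def by (meson not_less)
  obtain M where M: "M > 0" "\<And>v. \<bar>X v - L * v\<bar> \<le> M"
    using shift_near_linear[of X L] cont shift by metis
  define N where "N = 2 * M / L"
  have bound: "b \<le> N" if "X (v + b) \<le> X v" for v b
  proof -
    have "L * b \<le> 2 * M" using M(2)[of "v + b"] M(2)[of v] that by (simp add: algebra_simps abs_le_iff)
    then show ?thesis using L_pos by (simp add: N_def field_simps)
  qed
  \<comment> \<open>By periodicity it suffices to look for \<open>u\<close> in a compact interval, so a maximum exists.\<close>
  have reduce: "X (frac v + b) - X (frac v) = X (v + b) - X v" for v b
    using shift_int[of "frac v" "\<lfloor>v\<rfloor>"] shift_int[of "frac v + b" "\<lfloor>v\<rfloor>"]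
    by (simp add: frac_def algebra_simps)
  define S where "S = {p \<in> {0..N} \<times> {0..1}. X (snd p + fst p) \<le> X (snd p)}"
  have in_S: "(b, frac v) \<in> S" if "X (v + b) \<le> X v" "b \<ge> 0" for v b
    using that bound[OF that(1)] reduce[of v b] by (auto simp: S_def frac_lt_1 less_imp_le)
  have "compact S"
  proof -
    have "closed {p. X (snd p + fst p) \<le> X (snd p)}"
      by (intro closed_Collect_le continuous_intros continuous_on_compose2[OF cont]) auto
    moreover have "S = ({0..N} \<times> {0..1}) \<inter> {p. X (snd p + fst p) \<le> X (snd p)}"
      by (auto simp: S_def)
    ultimately show ?thesis by (simp add: compact_Int_closed compact_Times)
  qed
  moreover have wS: "(w1 - w0, frac w0) \<in> S" using in_S[of w0 "w1 - w0"] w by simp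
  ultimately obtain p where p: "p \<in> S" "\<And>q. q \<in> S \<Longrightarrow> fst q \<le> fst p"
    using continuous_attains_sup[of S fst] continuous_on_fst[OF continuous_on_id] by blast
  define a u where "a = fst p" and "u = snd p"
  have "a > 0" using p(2)[OF wS] w(1) by (simp add: a_def)
  have above: "X v < X (v + b)" if "b > a" for v b
  proof (rule ccontr)
    assume "\<not> X v < X (v + b)"
    then have "b \<le> a" using p(2)[OF in_S[of v b]] \<open>a > 0\<close> that by (simp add: a_def)
    then show False using that by simp
  qed
  have ge: "X v \<le> X (v + a)" for v
  proof (rule tendsto_lowerbound)
    have "isCont X (v + a)" using cont by (simp add: continuous_on_eq_continuous_at)
    then have "isCont (\<lambda>b. X (v + b)) a" by (intro isCont_o2[of a "\<lambda>b. v + b" X]) auto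
    then show "((\<lambda>b. X (v + b)) \<longlongrightarrow> X (v + a)) (at_right a)"
      unfolding isCont_def by (rule filterlim_mono) (auto simp: at_le)
    show "\<forall>\<^sub>F b in at_right a. X v \<le> X (v + b)"
      using eventually_at_right_less[of a] by eventually_elim (use above less_imp_le in blast)
  qed simp
  have touch: "X (u + a) = X u" using ge[of u] p(1) by (simp add: S_def a_def u_def)
  have "X (u + \<theta>) = X (u + a + \<theta>)"
  proof -
    have "consec (X (u + a - \<theta>)) (X u) (X (u + a + \<theta>))" using orbit[of "u + a"] touch by simp
    from twist[OF orbit[of u] this] show ?thesis
      using ge[of "u + \<theta>"] ge[of "u - \<theta>"] by (simp add: algebra_simps)
  qed
  from determined[OF touch[symmetric] this] \<open>a > 0\<close> show False by simp
qed

lemma X_surj: "surj X"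
  using cont shift L_pos by (rule shift_surj)

text \<open>Since the curve is a graph, every impact parameter belongs to an orbit on it.  Push a given orbit of the same rotation type, here the image of an orbit
  under a symmetry \<open>\<rho>\<close>, against the curve from below; at the point of contact the twist condition
  shows that it is an orbit of the curve.  The phase \<open>\<phi> u - u\<close> of the image is thus constant along
  orbits.\<close>

lemma symmetry_commutes:
  assumes mono: "strict_mono \<rho>" and \<rho>_shift: "\<And>t. \<rho> (t + L) = \<rho> t + L"
    and \<rho>_consec: "\<And>x0 x1 x2. consec x0 x1 x2 \<Longrightarrow> consec (\<rho> x0) (\<rho> x1) (\<rho> x2)"
    and "k > 0" and rational: "real k * \<theta> = of_int n"
  obtains \<phi> where "strict_mono \<phi>" and "\<And>u. X (\<phi> u) = \<rho> (X u)" and "\<And>u. \<phi> (u + 1) = \<phi> u + 1"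
    and "\<And>u. \<phi> (u + \<theta>) = \<phi> u + \<theta>"
proof -
  define \<phi> where "\<phi> u = inv X (\<rho> (X u))" for u
  have \<phi>: "X (\<phi> u) = \<rho> (X u)" for u unfolding \<phi>_def using X_surj by (rule surj_f_inv_f)
  note X_less = strict_mono_less[OF X_strict_mono] and X_le = strict_mono_less_eq[OF X_strict_mono]
    and X_eq = strict_mono_eq[OF X_strict_mono]
  have \<phi>_mono: "strict_mono \<phi>"
  proof (rule strict_monoI)
    fix u v :: real assume "u < v"
    then have "X (\<phi> u) < X (\<phi> v)" using mono X_less by (simp add: \<phi> strict_monoD)
    then show "\<phi> u < \<phi> v" by (simp add: X_less)
  qed
  have \<phi>_shift: "\<phi> (u + 1) = \<phi> u + 1" for u
  proof -
    have "X (\<phi> (u + 1)) = X (\<phi> u + 1)" by (simp add: \<phi> shift \<rho>_shift)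
    then show ?thesis by (simp add: X_eq)
  qed
  define \<psi> where "\<psi> u = \<phi> u - u" for u
  have \<psi>_period: "\<psi> (u + of_int j) = \<psi> u" for u j
    using shift_of_int[of \<phi> 1 1, OF \<phi>_shift, of u j] by (simp add: \<psi>_def)
  have "\<psi> (u + \<theta>) = \<psi> u" for u
  proof -
    obtain i where i: "i < k" "\<And>j. j < k \<Longrightarrow> \<psi> (u + of_nat j * \<theta>) \<le> \<psi> (u + of_nat i * \<theta>)"
    proof -
      have "Max ((\<lambda>j. \<psi> (u + of_nat j * \<theta>)) ` {..<k}) \<in> (\<lambda>j. \<psi> (u + of_nat j * \<theta>)) ` {..<k}"
        using \<open>k > 0\<close> by (intro Max_in) auto
      then obtain i where "i < k" "Max ((\<lambda>j. \<psi> (u + of_nat j * \<theta>)) ` {..<k}) = \<psi> (u + of_nat i * \<theta>)"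
        by auto
      then show thesis using that[of i] Max_ge[of "(\<lambda>j. \<psi> (u + of_nat j * \<theta>)) ` {..<k}"] by auto
    qed
    \<comment> \<open>The phase has period \<open>1\<close> and \<open>k * \<theta>\<close> is an integer, so this maximum is attained over the
      whole orbit, in both directions of time.\<close>
    define a where "a = \<psi> (u + of_nat i * \<theta>)"
    have le: "\<psi> (u + of_int j * \<theta>) \<le> a" for j
    proof -
      have "u + of_int j * \<theta> = u + of_nat (nat (j mod int k)) * \<theta> + of_int (j div int k * n)"
      proof -
        have "j = int k * (j div int k) + int (nat (j mod int k))" using \<open>k > 0\<close> by simp
        then have "of_int j = real k * of_int (j div int k) + real (nat (j mod int k))"
          by (metis of_int_add of_int_mult of_int_of_nat_eq)
        then have "of_int j * \<theta> = real k * \<theta> * of_int (j div int k) + real (nat (j mod int k)) * \<theta>"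
          by (simp add: algebra_simps)
        then show ?thesis using rational by simp
      qed
      then have "\<psi> (u + of_int j * \<theta>) = \<psi> (u + of_nat (nat (j mod int k)) * \<theta>)"
        by (simp only: \<psi>_period)
      also have "\<dots> \<le> a" unfolding a_def using \<open>k > 0\<close> by (intro i(2)) (simp add: nat_less_iff)
      finally show ?thesis .
    qed
    have contact: "\<psi> (u + of_int (j + 1) * \<theta>) = a" if eq: "\<psi> (u + of_int j * \<theta>) = a" for j
    proof -
      define v where "v = u + of_int j * \<theta>"
      have "\<phi> v = v + a" using eq unfolding \<psi>_def v_def by linarith
      then have "\<rho> (X v) = X (v + a)" using \<phi>[of v] by simp
      then have "consec (\<rho> (X (v - \<theta>))) (X (v + a)) (\<rho> (X (v + \<theta>)))"
        using \<rho>_consec[OF orbit[of v]] by simp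
      moreover have "\<rho> (X (v + \<theta>)) \<le> X (v + a + \<theta>)" "\<rho> (X (v - \<theta>)) \<le> X (v + a - \<theta>)"
        using le[of "j + 1"] le[of "j - 1"]
        by (simp_all add: \<phi>[symmetric] X_le \<psi>_def v_def algebra_simps)
      ultimately have "\<rho> (X (v + \<theta>)) = X (v + a + \<theta>)"
        using twist orbit[of "v + a"] by blast
      then have "\<phi> (v + \<theta>) = v + a + \<theta>" by (simp add: \<phi>[symmetric] X_eq)
      then show ?thesis by (simp add: \<psi>_def v_def algebra_simps)
    qed
    have all: "\<psi> (u + of_int (int i + int l) * \<theta>) = a" for l
    proof (induction l)
      case (Suc l)
      then show ?case using contact[of "int i + int l"] by (simp add: algebra_simps)
    qed (simp add: a_def)
    have "\<psi> (u + of_int n) = a" using all[of "k - i"] i(1) rational by (simp add: of_nat_diff)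
    moreover have "\<psi> (u + \<theta> + of_int n) = a"
      using all[of "Suc (k - i)"] i(1) rational by (simp add: of_nat_diff algebra_simps)
    ultimately show ?thesis by (simp add: \<psi>_period)
  qed
  then have "\<phi> (u + \<theta>) = \<phi> u + \<theta>" for u
    unfolding \<psi>_def by (smt (verit))
  with \<phi>_mono \<phi> \<phi>_shift show thesis by (rule that)
qed

text \<open>In the coordinate of the curve, the symmetry commutes with the translations by \<open>\<theta>\<close> and by \<open>1\<close>,
  hence with the translation by \<open>1 / k\<close>, and its \<open>k\<close>-th power is an integer translation.\<close>

lemma symmetry_is_translation:
  assumes mono: "strict_mono \<rho>" and \<rho>_shift: "\<And>t. \<rho> (t + L) = \<rho> t + L"
    and \<rho>_consec: "\<And>x0 x1 x2. consec x0 x1 x2 \<Longrightarrow> consec (\<rho> x0) (\<rho> x1) (\<rho> x2)"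
    and \<rho>_pow: "\<And>t. \<exists>j::int. (\<rho> ^^ k) t = t + of_int j * L"
    and "k > 0" and \<theta>: "\<theta> = of_int n / real k" and coprime: "coprime n (int k)"
  obtains m :: int where "\<And>u. \<rho> (X u) = X (u + of_int m / k)"
proof -
  have rational: "real k * \<theta> = of_int n" using \<theta> \<open>k > 0\<close> by simp
  obtain \<phi> where \<phi>: "strict_mono \<phi>" "\<And>u. X (\<phi> u) = \<rho> (X u)"
      "\<And>u. \<phi> (u + 1) = \<phi> u + 1" "\<And>u. \<phi> (u + \<theta>) = \<phi> u + \<theta>"
    by (rule symmetry_commutes[OF mono \<rho>_shift _ \<open>k > 0\<close> rational]) (use \<rho>_consec in blast)+
  obtain a b where "a * n + b * int k = 1"
    using bezout_int[of n "int k"] coprime by (auto simp: coprime_iff_gcd_eq_1)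
  then have "real_of_int (a * n + b * int k) = 1" by simp
  then have frac: "1 / real k = of_int a * \<theta> + of_int b * 1"
    using \<open>k > 0\<close> by (simp add: \<theta> field_simps)
  have "\<phi> (u + 1 / k) = \<phi> u + 1 / k" for u
    unfolding frac add.assoc[symmetric]
    using shift_of_int[of \<phi> 1 1, OF \<phi>(3), of "u + of_int a * \<theta>" b]
      shift_of_int[of \<phi> \<theta> \<theta>, OF \<phi>(4), of u a] by simp
  moreover have "(\<phi> ^^ k) u - u \<in> \<int>" for u
  proof -
    have "X ((\<phi> ^^ i) u) = (\<rho> ^^ i) (X u)" for i by (induction i) (auto simp: \<phi>(2))
    then obtain j :: int where "X ((\<phi> ^^ k) u) = X u + of_int j * L" using \<rho>_pow by metis
    then have "X ((\<phi> ^^ k) u) = X (u + of_int j)" by (simp add: shift_int)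
    then show ?thesis by (simp add: strict_mono_eq[OF X_strict_mono])
  qed
  ultimately obtain m :: int where "\<And>u. \<phi> u = u + of_int m / k"
    using root_of_translation[OF \<phi>(1) \<open>k > 0\<close>] by blast
  then show thesis using that[of m] \<phi>(2) by simp
qed

end

section \<open>The twist property of a strictly convex curve\<close>

lemma det2_eq: "det2 u v = u $ 1 * v $ 2 - u $ 2 * v $ 1"
  by (simp add: det_2)

lemma det2_diff_right: "det2 u (v - w) = det2 u v - det2 u w"
  and det2_scaleR_right: "det2 u (r *\<^sub>R v) = r * det2 u v"
  and det2_scaleR_left: "det2 (r *\<^sub>R u) v = r * det2 u v"
  and det2_swap: "det2 v u = - det2 u v"
  and det2_self: "det2 u u = 0"
  by (simp_all add: det2_eq algebra_simps)

lemma det2_has_derivative: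
  assumes "(\<gamma> has_vector_derivative v) (at t)"
  shows "((\<lambda>t. det2 w (\<gamma> t)) has_real_derivative det2 w v) (at t)"
proof -
  have *: "((\<lambda>t. \<gamma> t $ i) has_real_derivative v $ i) (at t)" for i
    using bounded_linear.has_vector_derivative[OF bounded_linear_vec_nth assms]
    by (simp add: has_real_derivative_iff_has_vector_derivative)
  show ?thesis unfolding det2_eq
    by (rule derivative_eq_intros * refl)+ simp
qed

lemma det2_zero_imp_parallel:
  assumes "det2 v w = 0" and "v \<noteq> 0"
  obtains r where "w = r *\<^sub>R v"
proof -
  have eq: "v $ 1 * w $ 2 = v $ 2 * w $ 1" using assms(1) by (simp add: det2_eq)
  consider "v $ 1 \<noteq> 0" | "v $ 2 \<noteq> 0" using assms(2) by (auto simp: vec_eq_iff forall_2)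
  then show thesis
  proof cases
    case 1
    then have "w = (w $ 1 / v $ 1) *\<^sub>R v" using eq by (simp add: vec_eq_iff forall_2 field_simps)
    then show thesis by (rule that)
  next
    case 2
    then have "w = (w $ 2 / v $ 2) *\<^sub>R v" using eq by (simp add: vec_eq_iff forall_2 field_simps)
    then show thesis by (rule that)
  qed
qed

text \<open>The last assumption is the form in which strict convexity governs the dynamics: the curve lies
  strictly to the left of each of its tangents.\<close>

locale convex_curve =
  fixes \<gamma> \<gamma>' :: "real \<Rightarrow> real^2" and L :: real
  assumes L_pos: "L > 0"
    and period: "\<gamma> (t + L) = \<gamma> t"
    and inj: "inj_on \<gamma> {0..<L}"
    and deriv: "(\<gamma> has_vector_derivative \<gamma>' t) (at t)"
    and cont_deriv: "continuous_on UNIV \<gamma>'"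
    and left_of_tangent: "\<gamma> a \<noteq> \<gamma> b \<Longrightarrow> 0 < det2 (\<gamma>' a) (\<gamma> b - \<gamma> a)"
begin

lemma period_int: "\<gamma> (t + of_int j * L) = \<gamma> t"
  using shift_of_int[of \<gamma> L 0] period by simp

lemma curve_eq_iff: "\<gamma> a = \<gamma> b \<longleftrightarrow> (\<exists>j::int. a = b + of_int j * L)"
proof
  assume eq: "\<gamma> a = \<gamma> b"
  define red where "red t = t + of_int (- \<lfloor>t / L\<rfloor>) * L" for t
  have "red t = frac (t / L) * L" for t using L_pos by (simp add: red_def frac_def field_simps)
  then have "red t \<in> {0..<L}" for t
    using L_pos by (simp add: frac_lt_1)
  moreover have "\<gamma> (red t) = \<gamma> t" for t unfolding red_def by (rule period_int)
  ultimately have "red a = red b" using inj eq by (metis inj_onD)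
  then have "a = b + of_int (\<lfloor>a / L\<rfloor> - \<lfloor>b / L\<rfloor>) * L" by (simp add: red_def algebra_simps)
  then show "\<exists>j::int. a = b + of_int j * L" by blast
next
  assume "\<exists>j::int. a = b + of_int j * L"
  then show "\<gamma> a = \<gamma> b" using period_int by auto
qed

lemma curve_neq: "a < b \<Longrightarrow> b < a + L \<Longrightarrow> \<gamma> a \<noteq> \<gamma> b"
proof
  assume *: "a < b" "b < a + L" "\<gamma> a = \<gamma> b"
  then obtain j :: int where j: "b = a + of_int j * L" using curve_eq_iff[of b a] by auto
  then have "0 < of_int j * L" "of_int j * L < 1 * L" using * by auto
  then have "0 < j" "j < 1" using L_pos by (auto simp: zero_less_mult_iff simp del: mult_1)
  then show False by simp
qed

lemma representative:
  obtains b' where "b' \<in> {a..<a + L}" and "\<gamma> b' = \<gamma> b"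
proof -
  define b' where "b' = b + of_int (- \<lfloor>(b - a) / L\<rfloor>) * L"
  have "b' - a = frac ((b - a) / L) * L" using L_pos by (simp add: b'_def frac_def field_simps)
  then have "0 \<le> b' - a" "b' - a < L" using L_pos by (simp_all add: frac_lt_1)
  moreover have "\<gamma> b' = \<gamma> b" unfolding b'_def by (rule period_int)
  ultimately show thesis using that[of b'] by simp
qed

lemma velocity_nonzero: "\<gamma>' a \<noteq> 0"
  using left_of_tangent[of a "a + L / 2"] curve_neq[of a "a + L / 2"] L_pos by (auto simp: det2_eq)

lemma height_deriv: "((\<lambda>t. det2 v (\<gamma> t)) has_real_derivative det2 v (\<gamma>' t)) (at t)"
  by (rule det2_has_derivative[OF deriv])

lemma height_cont: "continuous_on S (\<lambda>t. det2 v (\<gamma> t))"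
  using height_deriv by (meson DERIV_continuous continuous_at_imp_continuous_on)

text \<open>A line in direction \<open>v\<close> enters the convex region at one end of the chord and leaves
  it at the other.\<close>

lemma opposite_slopes:
  assumes "v \<noteq> 0" and eq: "det2 v (\<gamma> a) = det2 v (\<gamma> b)" and ab: "\<gamma> a \<noteq> \<gamma> b"
  shows "det2 v (\<gamma>' a) * det2 v (\<gamma>' b) < 0"
proof -
  have "det2 v (\<gamma> b - \<gamma> a) = 0" using eq by (simp only: det2_diff_right)
  then obtain r where r: "\<gamma> b - \<gamma> a = r *\<^sub>R v" using det2_zero_imp_parallel assms(1) by blast
  have "r * det2 v (\<gamma>' a) < 0"
    using left_of_tangent[OF ab] unfolding r det2_scaleR_right det2_swap[of "\<gamma>' a"] by simp
  moreover have "\<gamma> a - \<gamma> b = (- r) *\<^sub>R v" using r by (simp add: algebra_simps)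
  then have "r * det2 v (\<gamma>' b) > 0"
    using left_of_tangent[OF ab[symmetric]] by (simp only: det2_scaleR_right det2_swap[of "\<gamma>' b"])
  ultimately show ?thesis
    by (auto simp: zero_less_mult_iff mult_less_0_iff)
qed

lemma no_three_on_line:
  assumes "v \<noteq> 0" and "a < b" "b < c" "c < a + L"
    and "det2 v (\<gamma> a) = h" "det2 v (\<gamma> b) = h" "det2 v (\<gamma> c) = h"
  shows False
proof -
  have "\<gamma> a \<noteq> \<gamma> b" "\<gamma> b \<noteq> \<gamma> c" "\<gamma> a \<noteq> \<gamma> c" using assms by (intro curve_neq; simp)+
  then have "det2 v (\<gamma>' a) * det2 v (\<gamma>' b) < 0" "det2 v (\<gamma>' b) * det2 v (\<gamma>' c) < 0"
    "det2 v (\<gamma>' a) * det2 v (\<gamma>' c) < 0"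
    using opposite_slopes[of v] assms by simp_all
  then show False by (auto simp: mult_less_0_iff)
qed

text \<open>The height above the tangent line at \<open>x\<close> rises to its maximum and then falls, so it is
  monotone on the rising side and on the falling side.  A violation would give a horizontal line
  through three points of the curve.\<close>

lemma height_rising:
  assumes x: "x < a" "a < b" "b < x + L"
    and slopes: "0 < det2 (\<gamma>' x) (\<gamma>' a)" "0 < det2 (\<gamma>' x) (\<gamma>' b)"
  shows "det2 (\<gamma>' x) (\<gamma> a) < det2 (\<gamma>' x) (\<gamma> b)"
proof (rule ccontr)
  let ?h = "\<lambda>t. det2 (\<gamma>' x) (\<gamma> t)"
  assume "\<not> ?h a < ?h b"
  moreover have "?h a \<noteq> ?h b"
    using opposite_slopes[OF velocity_nonzero, of x a b] slopes curve_neq[of a b] x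
    by (auto simp: mult_less_0_iff)
  ultimately have ab: "?h b < ?h a" by simp
  have "?h x < ?h b"
    using left_of_tangent[of x b] curve_neq[of x b] x by (simp add: det2_diff_right)
  \<comment> \<open>The level of \<open>b\<close> is also reached on the way up to \<open>a\<close>, and, as the curve rises
    at \<open>b\<close>, once more between \<open>a\<close> and \<open>b\<close>.\<close>
  then obtain d where d: "x \<le> d" "d \<le> a" "?h d = ?h b"
    using IVT'[of ?h x "?h b" a] height_cont ab x by auto
  obtain e where e: "e > 0" "\<And>t. 0 < t \<Longrightarrow> t < e \<Longrightarrow> ?h (b - t) < ?h b"
    using DERIV_pos_inc_left[OF height_deriv slopes(2)] by auto
  define b' where "b' = b - min (e / 2) ((b - a) / 2)"
  have b': "a < b'" "b' < b" using e(1) x by (auto simp: b'_def min_def field_simps)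
  have "?h b' < ?h b" using e(2)[of "b - b'"] e(1) x by (simp add: b'_def)
  then obtain c where c: "a \<le> c" "c \<le> b'" "?h c = ?h b"
    using IVT2'[of ?h b' "?h b" a] height_cont ab b' by auto
  have "d \<noteq> a" "c \<noteq> a" "x \<noteq> d" using d c ab \<open>?h x < ?h b\<close> by auto
  then show False
    using no_three_on_line[OF velocity_nonzero, of d c b x "?h b"] d c b' x by simp
qed

lemma height_falling:
  assumes x: "x - L < a" "a < b" "b < x"
    and slopes: "det2 (\<gamma>' x) (\<gamma>' a) < 0" "det2 (\<gamma>' x) (\<gamma>' b) < 0"
  shows "det2 (\<gamma>' x) (\<gamma> b) < det2 (\<gamma>' x) (\<gamma> a)"
proof (rule ccontr)
  let ?h = "\<lambda>t. det2 (\<gamma>' x) (\<gamma> t)"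
  assume "\<not> ?h b < ?h a"
  moreover have "?h a \<noteq> ?h b"
    using opposite_slopes[OF velocity_nonzero, of x a b] slopes curve_neq[of a b] x
    by (auto simp: mult_less_0_iff)
  ultimately have ab: "?h a < ?h b" by simp
  have "?h x < ?h a"
    using left_of_tangent[of x a] curve_neq[of a x] x by (simp add: det2_diff_right)
  then obtain d where d: "b \<le> d" "d \<le> x" "?h d = ?h a"
    using IVT2'[of ?h x "?h a" b] height_cont ab x by auto
  obtain e where e: "e > 0" "\<And>t. 0 < t \<Longrightarrow> t < e \<Longrightarrow> ?h (a + t) < ?h a"
    using DERIV_neg_dec_right[OF height_deriv slopes(1)] by auto
  define a' where "a' = a + min (e / 2) ((b - a) / 2)"
  have a': "a < a'" "a' < b" using e(1) x by (auto simp: a'_def min_def field_simps)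
  have "?h a' < ?h a" using e(2)[of "a' - a"] e(1) x by (simp add: a'_def)
  then obtain c where c: "a' \<le> c" "c \<le> b" "?h c = ?h a"
    using IVT'[of ?h a' "?h a" b] height_cont ab a' by auto
  have "d \<noteq> b" "c \<noteq> b" "x \<noteq> d" using d c ab \<open>?h x < ?h a\<close> by auto
  then show False
    using no_three_on_line[OF velocity_nonzero, of a c d x "?h a"] d c a' x by simp
qed

text \<open>Consecutive impacts on the universal cover: as for the billiard map, the bounds by \<open>L\<close> select
  one representative of each point.\<close>

definition consec :: "real \<Rightarrow> real \<Rightarrow> real \<Rightarrow> bool" where
  "consec x0 x1 x2 \<longleftrightarrow> x0 < x1 \<and> x1 < x0 + L \<and> x1 < x2 \<and> x2 < x1 + L \<and>
     0 < det2 (\<gamma>' x0) (\<gamma>' x1) \<and> 0 < det2 (\<gamma>' x1) (\<gamma>' x2) \<and>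
     det2 (\<gamma>' x1) (\<gamma> x2 - \<gamma> x0) = 0"

text \<open>The chord from \<open>x0\<close> to \<open>x2\<close> is parallel to the tangent at \<open>x1\<close>: raising it moves \<open>x2\<close>
  forward and \<open>x0\<close> backward.\<close>

lemma consec_twist:
  assumes x: "consec x0 x1 x2" and y: "consec y0 x1 y2" and le: "x0 \<le> y0" "x2 \<le> y2"
  shows "x0 = y0 \<and> x2 = y2"
proof -
  let ?h = "\<lambda>t. det2 (\<gamma>' x1) (\<gamma> t)"
  have level: "?h x0 = ?h x2" "?h y0 = ?h y2" using x y by (auto simp: consec_def det2_diff_right)
  have slopes: "det2 (\<gamma>' x1) (\<gamma>' x0) < 0" "det2 (\<gamma>' x1) (\<gamma>' y0) < 0"
    using x y det2_swap[of "\<gamma>' x1"] by (simp_all only: consec_def neg_less_0_iff_less)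
  have "?h x2 < ?h y2" if "x2 < y2"
    using height_rising[of x1 x2 y2] x y that by (auto simp: consec_def)
  moreover have "?h y0 < ?h x0" if "x0 < y0"
    using height_falling[of x1 x0 y0] x y that slopes by (auto simp: consec_def)
  ultimately show ?thesis using le level by (cases "x0 = y0"; cases "x2 = y2") auto
qed

text \<open>Beyond \<open>b\<close> the curve leaves the line through \<open>\<gamma> a\<close> and \<open>\<gamma> b\<close> to the left, and it cannot meet
  that line a third time before it returns to \<open>\<gamma> a\<close>.\<close>

lemma chord_turns_left:
  assumes "a < b" "b < c" "c < a + L"
  shows "0 < det2 (\<gamma> b - \<gamma> a) (\<gamma> c - \<gamma> a)"
proof (rule ccontr)
  define v where "v = \<gamma> b - \<gamma> a"
  let ?h = "\<lambda>t. det2 v (\<gamma> t)"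
  assume "\<not> ?thesis"
  then have "?h c \<le> ?h a" by (simp add: v_def[symmetric] det2_diff_right)
  have ab: "\<gamma> a \<noteq> \<gamma> b" and "v \<noteq> 0" using curve_neq[of a b] assms by (auto simp: v_def)
  have "det2 v v = 0" by (rule det2_self)
  then have "?h b = ?h a" by (simp add: v_def det2_diff_right)
  have "det2 v (\<gamma>' b) = det2 (\<gamma>' b) (\<gamma> a - \<gamma> b)" by (simp add: v_def det2_eq algebra_simps)
  then have "0 < det2 v (\<gamma>' b)" using left_of_tangent[OF ab[symmetric]] by simp
  from DERIV_pos_inc_right[OF height_deriv this]
  obtain e where e: "e > 0" "\<And>t. 0 < t \<Longrightarrow> t < e \<Longrightarrow> ?h b < ?h (b + t)" by auto
  define b' where "b' = b + min (e / 2) ((c - b) / 2)"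
  have b': "b < b'" "b' < c" using e(1) assms by (auto simp: b'_def min_def field_simps)
  have "?h b < ?h b'" using e(2)[of "b' - b"] e(1) assms by (simp add: b'_def)
  then obtain d where "b' \<le> d" "d \<le> c" "?h d = ?h a"
    using IVT2'[of ?h c "?h a" b'] height_cont \<open>?h c \<le> ?h a\<close> \<open>?h b = ?h a\<close> b' by auto
  then show False
    using no_three_on_line[OF \<open>v \<noteq> 0\<close>, of a b d "?h a"] \<open>?h b = ?h a\<close> assms b' by simp
qed

text \<open>Tangent directions are recognised by the supporting line alone.  This replaces the derivative
  of the parameter change that a symmetry of the curve induces.\<close>

lemma support_imp_velocity:
  assumes support: "\<And>b. \<gamma> b \<noteq> \<gamma> a \<Longrightarrow> 0 < det2 v (\<gamma> b - \<gamma> a)"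
  obtains \<mu> where "\<mu> > 0" and "v = \<mu> *\<^sub>R \<gamma>' a"
proof -
  have "det2 v (\<gamma> a) \<le> det2 v (\<gamma> b)" for b
    using support[of b] by (cases "\<gamma> b = \<gamma> a") (auto simp: det2_diff_right)
  then have "det2 v (\<gamma>' a) = 0"
    using DERIV_local_min[OF height_deriv, of 1] by auto
  then have "det2 (\<gamma>' a) v = 0" using det2_swap[of v "\<gamma>' a"] by simp
  then obtain \<mu> where \<mu>: "v = \<mu> *\<^sub>R \<gamma>' a"
    using det2_zero_imp_parallel velocity_nonzero by blast
  define b where "b = a + L / 2"
  have b: "\<gamma> b \<noteq> \<gamma> a" using curve_neq[of a b] L_pos by (auto simp: b_def)
  have "0 < \<mu> * det2 (\<gamma>' a) (\<gamma> b - \<gamma> a)" using support[OF b] unfolding \<mu> det2_scaleR_left .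
  then have "\<mu> > 0" using left_of_tangent[of a b] b by (auto simp: zero_less_mult_iff)
  then show thesis using \<mu> by (rule that)
qed

end

section \<open>Linear symmetries of a strictly convex curve\<close>

context convex_curve
begin

text \<open>The cyclic order of three points of the curve is the orientation of the triangle that they
  span, which a linear map of determinant one preserves.  Its action on the curve therefore lifts
  to an increasing map of the parameter.\<close>

lemma linear_symmetry_lift:
  assumes "linear A" and "inj A" and invariant: "A ` range \<gamma> = range \<gamma>"
    and det: "\<And>u v. det2 (A u) (A v) = det2 u v"
  obtains \<rho> where "strict_mono \<rho>" and "\<And>t. \<rho> (t + L) = \<rho> t + L" and "\<And>t. \<gamma> (\<rho> t) = A (\<gamma> t)"
proof -
  have image: "\<exists>s. A (\<gamma> t) = \<gamma> s" for t using invariant by blast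
  obtain p where p: "\<gamma> p = A (\<gamma> 0)" using image[of 0] by metis
  have "\<exists>s. s \<in> {p..<p + L} \<and> \<gamma> s = A (\<gamma> t)" for t
  proof -
    obtain s where "A (\<gamma> t) = \<gamma> s" using image by blast
    then show ?thesis using representative[of p s] by metis
  qed
  then obtain r where r: "\<And>t. r t \<in> {p..<p + L}" "\<And>t. \<gamma> (r t) = A (\<gamma> t)" by metis
  have r_neq: "r s \<noteq> r t" if "s < t" "t < s + L" for s t
  proof
    assume "r s = r t"
    then have "A (\<gamma> s) = A (\<gamma> t)" using r(2)[of s] r(2)[of t] by simp
    then show False using injD[OF \<open>inj A\<close>] curve_neq[OF that] by blast
  qed
  have "r 0 = p"
  proof (rule ccontr)
    assume "r 0 \<noteq> p"
    then have "\<gamma> p \<noteq> \<gamma> (r 0)" using curve_neq[of p "r 0"] r(1)[of 0] by auto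
    then show False using r(2) p by simp
  qed
  have r_mono: "r s < r t" if "0 \<le> s" "s < t" "t < L" for s t
  proof (cases "s = 0")
    case True
    then have "r s = p" using \<open>r 0 = p\<close> by simp
    moreover have "r s \<noteq> r t" using r_neq[of s t] that by simp
    ultimately show ?thesis using r(1)[of t] by simp
  next
    case False
    have "0 < det2 (\<gamma> s - \<gamma> 0) (\<gamma> t - \<gamma> 0)" using chord_turns_left[of 0 s t] that False by simp
    also have "\<dots> = det2 (\<gamma> (r s) - \<gamma> p) (\<gamma> (r t) - \<gamma> p)"
      by (simp only: r(2) p linear_diff[OF \<open>linear A\<close>, symmetric] det)
    finally have pos: "0 < det2 (\<gamma> (r s) - \<gamma> p) (\<gamma> (r t) - \<gamma> p)" .
    have "p \<noteq> r t" using r_neq[of 0 t] that \<open>r 0 = p\<close> by simp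
    then have "p < r t" "r s < p + L" using r(1)[of t] r(1)[of s] by auto
    show ?thesis
    proof (rule ccontr)
      assume "\<not> r s < r t"
      then have "r t < r s" using r_neq[of s t] that by simp
      then have "0 < det2 (\<gamma> (r t) - \<gamma> p) (\<gamma> (r s) - \<gamma> p)"
        using chord_turns_left[of p "r t" "r s"] \<open>p < r t\<close> \<open>r s < p + L\<close> by simp
      then show False using pos det2_swap[of "\<gamma> (r s) - \<gamma> p" "\<gamma> (r t) - \<gamma> p"] by simp
    qed
  qed
  \<comment> \<open>\<open>r\<close> is increasing on one period only, and is extended from there.\<close>
  define \<rho> where "\<rho> t = r (t - of_int \<lfloor>t / L\<rfloor> * L) + of_int \<lfloor>t / L\<rfloor> * L" for t
  have red: "0 \<le> t - of_int \<lfloor>t / L\<rfloor> * L" "t - of_int \<lfloor>t / L\<rfloor> * L < L" for t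
    using L_pos floor_divide_lower[OF L_pos, of t] floor_divide_upper[OF L_pos, of t] by (auto simp: algebra_simps)
  have mono: "strict_mono \<rho>"
  proof (rule strict_monoI)
    fix s t :: real assume st: "s < t"
    have "\<lfloor>s / L\<rfloor> \<le> \<lfloor>t / L\<rfloor>" using st L_pos by (simp add: divide_right_mono floor_mono)
    then consider "\<lfloor>s / L\<rfloor> = \<lfloor>t / L\<rfloor>" | "\<lfloor>s / L\<rfloor> + 1 \<le> \<lfloor>t / L\<rfloor>" by linarith
    then show "\<rho> s < \<rho> t"
    proof cases
      case 1
      then show ?thesis using r_mono[OF red(1)[of s] _ red(2)[of t]] st by (simp add: \<rho>_def)
    next
      case 2
      then have "real_of_int (\<lfloor>s / L\<rfloor> + 1) * L \<le> of_int \<lfloor>t / L\<rfloor> * L" using L_pos by (intro mult_right_mono) linarith+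
      moreover have "r (s - of_int \<lfloor>s / L\<rfloor> * L) < p + L" "p \<le> r (t - of_int \<lfloor>t / L\<rfloor> * L)"
        using r(1) by auto
      ultimately show ?thesis by (simp add: \<rho>_def algebra_simps)
    qed
  qed
  have shift: "\<rho> (t + L) = \<rho> t + L" for t
  proof -
    have "\<lfloor>(t + L) / L\<rfloor> = \<lfloor>t / L\<rfloor> + 1" using L_pos by (simp add: add_divide_distrib)
    then show ?thesis by (simp add: \<rho>_def algebra_simps)
  qed
  have lift: "\<gamma> (\<rho> t) = A (\<gamma> t)" for t
  proof -
    have "\<gamma> (t - of_int \<lfloor>t / L\<rfloor> * L) = \<gamma> t" using period_int[of t "- \<lfloor>t / L\<rfloor>"] by simp
    then show ?thesis by (simp add: \<rho>_def period_int r(2))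
  qed
  from mono shift lift show thesis by (rule that)
qed

text \<open>The symmetry takes velocities to positive multiples of velocities and preserves areas, so it
  preserves the signs and zeros of the areas that define consecutive impacts.\<close>

lemma linear_symmetry_consec:
  assumes "linear A" and "inj A"
    and det: "\<And>u v. det2 (A u) (A v) = det2 u v"
    and mono: "strict_mono \<rho>" and shift: "\<And>t. \<rho> (t + L) = \<rho> t + L"
    and lift: "\<And>t. \<gamma> (\<rho> t) = A (\<gamma> t)" and invariant: "A ` range \<gamma> = range \<gamma>"
    and consec: "consec x0 x1 x2"
  shows "consec (\<rho> x0) (\<rho> x1) (\<rho> x2)"
proof -
  have velocity: "\<exists>\<mu>>0. A (\<gamma>' t) = \<mu> *\<^sub>R \<gamma>' (\<rho> t)" for t
  proof -
    have "0 < det2 (A (\<gamma>' t)) (\<gamma> b - \<gamma> (\<rho> t))" if "\<gamma> b \<noteq> \<gamma> (\<rho> t)" for b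
    proof -
      have "\<gamma> b \<in> A ` range \<gamma>" by (simp only: invariant rangeI)
      then obtain s where s: "\<gamma> b = A (\<gamma> s)" by blast
      then have "\<gamma> t \<noteq> \<gamma> s" using that lift[of t] by auto
      then have "0 < det2 (\<gamma>' t) (\<gamma> s - \<gamma> t)" by (rule left_of_tangent)
      also have "\<dots> = det2 (A (\<gamma>' t)) (A (\<gamma> s) - A (\<gamma> t))"
        by (simp only: linear_diff[OF \<open>linear A\<close>, symmetric] det)
      finally show ?thesis by (simp only: s lift)
    qed
    from support_imp_velocity[OF this] show ?thesis by blast
  qed
  obtain \<mu> where \<mu>: "\<And>t. \<mu> t > 0" "\<And>t. A (\<gamma>' t) = \<mu> t *\<^sub>R \<gamma>' (\<rho> t)" using velocity by metis
  have slopes: "det2 (\<gamma>' s) (\<gamma>' t) = \<mu> s * (\<mu> t * det2 (\<gamma>' (\<rho> s)) (\<gamma>' (\<rho> t)))" for s t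
    by (simp only: det[of "\<gamma>' s", symmetric] \<mu>(2) det2_scaleR_left det2_scaleR_right mult.left_commute)
  have "0 < det2 (\<gamma>' (\<rho> s)) (\<gamma>' (\<rho> t))" if "0 < det2 (\<gamma>' s) (\<gamma>' t)" for s t
    using that \<mu>(1)[of s] \<mu>(1)[of t] unfolding slopes[of s t] by (simp add: zero_less_mult_iff)
  moreover have "det2 (\<gamma>' x1) (\<gamma> x2 - \<gamma> x0) = \<mu> x1 * det2 (\<gamma>' (\<rho> x1)) (\<gamma> (\<rho> x2) - \<gamma> (\<rho> x0))"
    by (simp only: det[of "\<gamma>' x1", symmetric] linear_diff[OF \<open>linear A\<close>] \<mu>(2) lift det2_scaleR_left)
  moreover have "\<rho> s < \<rho> t \<longleftrightarrow> s < t" for s t using mono by (rule strict_mono_less)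
  ultimately show ?thesis
    using consec \<mu>(1)[of x1] unfolding consec_def shift[symmetric] by simp
qed

end

section \<open>Linear maps of finite order in the plane\<close>

lemma linear_expand:
  fixes A :: "real^2 \<Rightarrow> 'a::real_vector"
  assumes "linear A"
  shows "A v = v $ 1 *\<^sub>R A (axis 1 1) + v $ 2 *\<^sub>R A (axis 2 1)"
proof -
  have v: "v $ 1 *\<^sub>R axis 1 1 + v $ 2 *\<^sub>R axis 2 1 = v"
    by (simp add: vec_eq_iff forall_2 axis_def)
  have "A (v $ 1 *\<^sub>R axis 1 1 + v $ 2 *\<^sub>R axis 2 1) = v $ 1 *\<^sub>R A (axis 1 1) + v $ 2 *\<^sub>R A (axis 2 1)"
    by (simp only: linear_add[OF assms] linear_scale[OF assms])
  then show ?thesis by (simp only: v)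
qed

lemma linear_det2:
  assumes "linear A"
  shows "det2 (A u) (A v) = det2 (A (axis 1 1)) (A (axis 2 1)) * det2 u v"
  unfolding linear_expand[OF assms, of u] linear_expand[OF assms, of v]
  by (simp add: det2_eq algebra_simps)

lemma cayley_hamilton2:
  assumes "linear (A :: real^2 \<Rightarrow> real^2)"
  obtains t where "\<And>v. A (A v) = t *\<^sub>R A v - det2 (A (axis 1 1)) (A (axis 2 1)) *\<^sub>R v"
proof
  fix v
  show "A (A v) = (A (axis 1 1) $ 1 + A (axis 2 1) $ 2) *\<^sub>R A v
      - det2 (A (axis 1 1)) (A (axis 2 1)) *\<^sub>R v"
    by (simp only: linear_expand[OF assms, of "A v"])
      (simp add: linear_expand[OF assms, of v] vec_eq_iff forall_2 det2_eq algebra_simps)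
qed

locale finite_order_map =
  fixes A :: "real^2 \<Rightarrow> real^2" and k :: nat
  assumes lin: "linear A" and k_pos: "k > 0" and order: "A ^^ k = id"
begin

text \<open>A linear map of finite order is an isometry of this sum of inner products over its powers.\<close>

definition orbit_inner :: "real^2 \<Rightarrow> real^2 \<Rightarrow> real" where
  "orbit_inner v w = (\<Sum>i<k. (A ^^ i) v \<bullet> (A ^^ i) w)"

lemma linear_power: "linear (A ^^ i)"
proof (induction i)
  case (Suc i)
  from linear_compose[OF this lin] show ?case by (simp only: funpow.simps)
qed (simp add: id_def linear_iff)

lemma orbit_inner_add_left: "orbit_inner (u + v) w = orbit_inner u w + orbit_inner v w"
  and orbit_inner_diff_left: "orbit_inner (u - v) w = orbit_inner u w - orbit_inner v w"
  and orbit_inner_scaleR_left: "orbit_inner (r *\<^sub>R v) w = r * orbit_inner v w"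
  by (simp_all add: orbit_inner_def linear_add[OF linear_power] linear_diff[OF linear_power]
      linear_scale[OF linear_power] inner_add_left inner_diff_left sum.distrib sum_subtractf
      sum_distrib_left)

lemma orbit_inner_zero: "orbit_inner 0 0 = 0"
  using orbit_inner_scaleR_left[of 0 0 0] by simp

lemma orbit_inner_commute: "orbit_inner v w = orbit_inner w v"
  by (simp add: orbit_inner_def inner_commute)

lemma orbit_inner_add_right: "orbit_inner w (u + v) = orbit_inner w u + orbit_inner w v"
  and orbit_inner_diff_right: "orbit_inner w (u - v) = orbit_inner w u - orbit_inner w v"
  and orbit_inner_scaleR_right: "orbit_inner w (r *\<^sub>R v) = r * orbit_inner w v"
  by (simp_all add: orbit_inner_commute[of w] orbit_inner_add_left orbit_inner_diff_left orbit_inner_scaleR_left)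

lemmas orbit_inner_bilinear = orbit_inner_add_left orbit_inner_diff_left orbit_inner_scaleR_left
  orbit_inner_add_right orbit_inner_diff_right orbit_inner_scaleR_right

lemma orbit_inner_pos: "v \<noteq> 0 \<Longrightarrow> 0 < orbit_inner v v"
  unfolding orbit_inner_def using k_pos by (intro sum_pos2[of _ 0]) auto

lemma orbit_inner_eq_0: "orbit_inner v v = 0 \<Longrightarrow> v = 0"
  using orbit_inner_pos[of v] by auto

lemma orbit_inner_invariant: "orbit_inner (A v) (A w) = orbit_inner v w"
proof -
  define F where "F i = (A ^^ i) v \<bullet> (A ^^ i) w" for i
  have "orbit_inner (A v) (A w) = (\<Sum>i<k. F (Suc i))"
    unfolding orbit_inner_def F_def by (simp add: funpow_swap1)
  also have "\<dots> = (\<Sum>i<k. F i) + F k - F 0"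
    using sum.lessThan_Suc_shift[of F k] sum.lessThan_Suc[of F k] by simp
  finally show ?thesis by (simp add: orbit_inner_def F_def order)
qed

lemma inj_A: "inj A"
proof (rule injI)
  fix v w assume "A v = A w"
  then have "A (v - w) = 0" by (simp add: linear_diff[OF lin])
  then have "orbit_inner (v - w) (v - w) = 0"
    using orbit_inner_invariant[of "v - w" "v - w"] orbit_inner_zero by simp
  then show "v = w" using orbit_inner_eq_0[of "v - w"] by simp
qed

lemma orbit_inner_invariant_power: "orbit_inner ((A ^^ i) v) ((A ^^ i) w) = orbit_inner v w"
  by (induction i) (simp_all add: orbit_inner_invariant)

lemma det_abs: "\<bar>det2 (A (axis 1 1)) (A (axis 2 1))\<bar> = 1"
proof -
  define d where "d = det2 (A (axis 1 1)) (A (axis 2 1))"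
  have "det2 ((A ^^ i) u) ((A ^^ i) v) = d ^ i * det2 u v" for i u v
    by (induction i) (simp_all add: linear_det2[OF lin, of "(A ^^ _) u"] d_def)
  from this[of k "axis 1 1" "axis 2 1"] have "d ^ k = 1"
    by (simp add: order det2_eq axis_def)
  then have "\<bar>d\<bar> ^ k = 1 ^ k" by (simp add: power_abs[symmetric])
  then have "\<bar>d\<bar> = 1" using k_pos power_eq_imp_eq_base by (metis abs_ge_zero zero_le_one)
  then show ?thesis by (simp only: d_def)
qed

text \<open>An isometry that reverses the orientation of the plane is a reflection, hence an involution.\<close>

lemma det_one:
  assumes "A \<circ> A \<noteq> id"
  shows "det2 (A u) (A v) = det2 u v"
proof -
  define d where "d = det2 (A (axis 1 1)) (A (axis 2 1))"
  obtain t where t: "\<And>v. A (A v) = t *\<^sub>R A v - d *\<^sub>R v"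
    using cayley_hamilton2[OF lin] unfolding d_def by blast
  have "d \<noteq> - 1"
  proof
    assume d: "d = - 1"
    \<comment> \<open>Now \<open>A\<^sup>2 = t A + 1\<close>, and comparing lengths forces the trace \<open>t\<close> to vanish.\<close>
    have "t * orbit_inner v v = 0" for v
    proof -
      have "orbit_inner v (A v) = orbit_inner (A v) (A (A v))" by (simp add: orbit_inner_invariant)
      also have "\<dots> = t * orbit_inner v v + orbit_inner v (A v)"
        by (simp add: t d orbit_inner_bilinear orbit_inner_invariant orbit_inner_commute[of "A v" v])
      finally show ?thesis by simp
    qed
    then have "t = 0" using orbit_inner_pos[of "axis 1 1"] by (metis axis_eq_0_iff less_irrefl mult_eq_0_iff zero_neq_one)
    then have "A (A v) = v" for v by (simp add: t d)
    then show False using assms by (auto simp: fun_eq_iff)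
  qed
  then have "d = 1" using det_abs unfolding d_def[symmetric] by (simp add: abs_if split: if_splits)
  then show ?thesis using linear_det2[OF lin, of u v] by (simp add: d_def)
qed

text \<open>Likewise, an orientation preserving isometry that fixes a nonzero vector is the identity.\<close>

lemma no_fixed_vector:
  assumes "A \<circ> A \<noteq> id" and "A w = w"
  shows "w = 0"
proof (rule ccontr)
  assume "w \<noteq> 0"
  have "det2 (A (axis 1 1)) (A (axis 2 1)) = 1"
    by (simp only: det_one[OF assms(1)]) (simp add: det2_eq axis_def)
  then obtain t where t: "\<And>v. A (A v) = t *\<^sub>R A v - v"
    using cayley_hamilton2[OF lin] by auto
  have "(2 - t) *\<^sub>R w = 0" using t[of w] assms(2) by (simp add: algebra_simps scaleR_2)
  then have "t = 2" using \<open>w \<noteq> 0\<close> by simp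
  have "A v = v" for v
  proof -
    have "orbit_inner v (A v) = orbit_inner (A v) (A (A v))" by (simp add: orbit_inner_invariant)
    also have "\<dots> = 2 * orbit_inner v v - orbit_inner v (A v)"
      by (simp add: t \<open>t = 2\<close> orbit_inner_bilinear orbit_inner_invariant orbit_inner_commute[of "A v" v])
    finally have "orbit_inner (A v - v) (A v - v) = 0"
      by (simp add: orbit_inner_bilinear orbit_inner_invariant orbit_inner_commute[of "A v" v])
    then show ?thesis using orbit_inner_eq_0 by force
  qed
  then show False using assms(1) by (auto simp: fun_eq_iff)
qed

lemma orbit_inner_has_derivative:
  assumes "(\<gamma> has_vector_derivative v) (at t)"
  shows "((\<lambda>t. orbit_inner (\<gamma> t) (\<gamma> t)) has_real_derivative 2 * orbit_inner (\<gamma> t) v) (at t)"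
proof -
  have "((\<lambda>t. (A ^^ i) (\<gamma> t) \<bullet> (A ^^ i) (\<gamma> t)) has_vector_derivative 2 * ((A ^^ i) (\<gamma> t) \<bullet> (A ^^ i) v)) (at t)"
    for i
  proof -
    have "bounded_linear (A ^^ i)" using linear_power by (rule linear_conv_bounded_linear[THEN iffD1])
    then have "((\<lambda>t. (A ^^ i) (\<gamma> t)) has_vector_derivative (A ^^ i) v) (at t)"
      using assms by (rule bounded_linear.has_vector_derivative)
    from bounded_bilinear.has_vector_derivative[OF bounded_bilinear_inner this this]
    show ?thesis by (simp add: inner_commute)
  qed
  then have "((\<lambda>t. orbit_inner (\<gamma> t) (\<gamma> t)) has_vector_derivative (\<Sum>i<k. 2 * ((A ^^ i) (\<gamma> t) \<bullet> (A ^^ i) v))) (at t)"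
    unfolding orbit_inner_def by (intro has_vector_derivative_sum)
  then show ?thesis
    by (simp add: has_real_derivative_iff_has_vector_derivative orbit_inner_def sum_distrib_left)
qed

text \<open>A linear map that takes the standard basis to an orthogonal basis, with vectors of square
  length \<open>c\<close>, takes the unit circle to the level set.\<close>

lemma ellipse_orbit_inner_level:
  assumes "c > 0"
  shows "ellipse {v. orbit_inner v v = c}"
proof -
  define e :: "real^2" where "e = axis 1 1"
  define w :: "real^2" where "w = axis 2 1 - (orbit_inner e (axis 2 1) / orbit_inner e e) *\<^sub>R e"
  have "e \<noteq> 0" by (simp add: e_def axis_eq_0_iff)
  have "w $ 2 = 1" by (simp add: w_def e_def axis_def)
  then have "w \<noteq> 0" by auto
  note pos = orbit_inner_pos[OF \<open>e \<noteq> 0\<close>] orbit_inner_pos[OF \<open>w \<noteq> 0\<close>]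
  have ew: "orbit_inner e w = 0" using pos by (simp add: w_def orbit_inner_bilinear)
  define f :: "real^2 \<Rightarrow> real^2" where
    "f p = (p $ 1 * sqrt (c / orbit_inner e e)) *\<^sub>R e + (p $ 2 * sqrt (c / orbit_inner w w)) *\<^sub>R w" for p
  have "linear f" by (rule linearI) (simp_all add: f_def algebra_simps)
  have Gf: "orbit_inner (f p) (f p) = c * (norm p)\<^sup>2" for p
  proof -
    have "orbit_inner (f p) (f p) = (p $ 1)\<^sup>2 * (sqrt (c / orbit_inner e e))\<^sup>2 * orbit_inner e e
        + (p $ 2)\<^sup>2 * (sqrt (c / orbit_inner w w))\<^sup>2 * orbit_inner w w"
      by (simp add: f_def orbit_inner_bilinear ew orbit_inner_commute[of w e] power2_eq_square algebra_simps)
    also have "\<dots> = (p $ 1)\<^sup>2 * c + (p $ 2)\<^sup>2 * c" using pos \<open>c > 0\<close> by simp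
    also have "\<dots> = c * (norm p)\<^sup>2"
      by (simp only: power2_norm_eq_inner) (simp add: inner_vec_def sum_2 power2_eq_square algebra_simps)
    finally show ?thesis .
  qed
  have "inj f"
  proof (rule linear_injective_0[OF \<open>linear f\<close>, THEN iffD2], intro allI impI)
    fix p assume "f p = 0"
    then have "c * (norm p)\<^sup>2 = 0" using Gf[of p] orbit_inner_zero by simp
    then show "p = 0" using \<open>c > 0\<close> by simp
  qed
  then have "bij f" using linear_injective_imp_surjective[OF \<open>linear f\<close>] by (simp add: bij_def)
  have "{v. orbit_inner v v = c} = (\<lambda>x. 0 + f x) ` sphere 0 1"
  proof (intro equalityI subsetI)
    fix v assume "v \<in> {v. orbit_inner v v = c}"
    moreover obtain p where "v = f p" using \<open>bij f\<close> by (metis bij_pointE)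
    ultimately have "v = f p" "(norm p)\<^sup>2 = 1\<^sup>2" using Gf[of p] \<open>c > 0\<close> by auto
    have "norm p = 1"
      using \<open>(norm p)\<^sup>2 = 1\<^sup>2\<close> norm_ge_zero zero_le_one by (rule power2_eq_imp_eq)
    with \<open>v = f p\<close> show "v \<in> (\<lambda>x. 0 + f x) ` sphere 0 1" by auto
  next
    fix v assume "v \<in> (\<lambda>x. 0 + f x) ` sphere 0 1"
    then show "v \<in> {v. orbit_inner v v = c}" using Gf by auto
  qed
  then show ?thesis unfolding ellipse_def using \<open>linear f\<close> \<open>bij f\<close> by blast
qed

end

section \<open>The symplectic billiard map\<close>

lemma continuous_on_det2 [continuous_intros]:
  "continuous_on S f \<Longrightarrow> continuous_on S g \<Longrightarrow> continuous_on S (\<lambda>x. det2 (f x) (g x))"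
  unfolding det2_eq by (intro continuous_intros)

lemma (in convex_curve) curve_cont: "continuous_on S \<gamma>"
  using deriv by (meson continuous_at_imp_continuous_on has_vector_derivative_continuous)

lemma (in convex_curve) velocity_eq:
  assumes "\<gamma> a = \<gamma> b"
  shows "\<gamma>' a = \<gamma>' b"
proof -
  obtain j :: int where j: "a = b + of_int j * L" using assms curve_eq_iff by blast
  have "((\<lambda>t. t + of_int j * L) has_vector_derivative 1) (at b)"
    by (auto intro!: derivative_eq_intros)
  from vector_diff_chain_at[OF this, of \<gamma> "\<gamma>' a"] deriv[of a]
  have "(\<gamma> has_vector_derivative \<gamma>' a) (at b)" by (simp add: j o_def period_int)
  then show ?thesis using deriv[of b] by (rule vector_derivative_unique_at)
qed

lemma billiard_step_iff:
  "billiard_step \<gamma> x y \<longleftrightarrow> 0 < det2 (velocity \<gamma> (fst x)) (velocity \<gamma> (fst y)) \<and>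
     snd x = - det2 (velocity \<gamma> (fst x)) (\<gamma> (fst y)) \<and> snd y = det2 (\<gamma> (fst x)) (velocity \<gamma> (fst y))"
  by (simp only: billiard_step_def case_prod_unfold fst_conv snd_conv)

locale billiard_table = convex_curve \<gamma> "velocity \<gamma>" L for \<gamma> L
begin

text \<open>Of the two points of the curve with the same height above the tangent at \<open>t\<close>, only the one on
  the rising side can be the next point of impact.  The weak inequalities make the relation closed,
  as needed for the continuity of the billiard map.\<close>

lemma next_impact_unique:
  assumes "t < a" "a < t + L" "0 < det2 (velocity \<gamma> t) (velocity \<gamma> a)"
    and "t \<le> b" "b \<le> t + L" "0 \<le> det2 (velocity \<gamma> t) (velocity \<gamma> b)"
    and "det2 (velocity \<gamma> t) (\<gamma> a) = det2 (velocity \<gamma> t) (\<gamma> b)"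
  shows "a = b"
proof -
  have "\<gamma> a = \<gamma> b"
    using opposite_slopes[OF velocity_nonzero assms(7)] assms(3,6)
    by (auto simp: mult_less_0_iff)
  moreover have "\<gamma> a \<noteq> \<gamma> t" using curve_neq[of t a] assms by auto
  moreover have "\<gamma> (t + L) = \<gamma> t" by (rule period)
  ultimately have "b \<noteq> t" "b \<noteq> t + L" by auto
  then show ?thesis
    using curve_neq[of a b] curve_neq[of b a] \<open>\<gamma> a = \<gamma> b\<close> assms by (cases a b rule: linorder_cases) auto
qed

lemma billiard_map_eqI:
  assumes y: "fst x < fst y" "fst y < fst x + L" "billiard_step \<gamma> x y"
    and z: "fst x \<le> fst z" "fst z \<le> fst x + L" "0 \<le> det2 (velocity \<gamma> (fst x)) (velocity \<gamma> (fst z))"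
      "snd x = - det2 (velocity \<gamma> (fst x)) (\<gamma> (fst z))" "snd z = det2 (\<gamma> (fst x)) (velocity \<gamma> (fst z))"
  shows "z = y"
proof -
  have "fst y = fst z"
    using y z by (intro next_impact_unique[of "fst x" "fst y" "fst z"]) (simp_all add: billiard_step_iff)
  moreover have "snd z = snd y" using y(3) z(5) calculation by (simp add: billiard_step_iff)
  ultimately show ?thesis by (simp add: prod_eq_iff)
qed

lemma billiard_map:
  assumes "x \<in> phase_space \<gamma>"
  shows "fst x < fst (billiard_map \<gamma> L x)" "fst (billiard_map \<gamma> L x) < fst x + L"
    "billiard_step \<gamma> x (billiard_map \<gamma> L x)"
proof -
  obtain t b where x: "x = (t, - det2 (velocity \<gamma> t) (\<gamma> b))"
      and b: "0 < det2 (velocity \<gamma> t) (velocity \<gamma> b)"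
    using assms by (auto simp: phase_space_def)
  obtain a where a: "a \<in> {t..<t + L}" "\<gamma> a = \<gamma> b" using representative by blast
  have vel: "velocity \<gamma> a = velocity \<gamma> b" using a(2) by (rule velocity_eq)
  have "a \<noteq> t" using b unfolding vel[symmetric] by (auto simp: det2_self)
  define y where "y = (a, det2 (\<gamma> t) (velocity \<gamma> a))"
  have y: "fst x < fst y \<and> fst y < fst x + L \<and> billiard_step \<gamma> x y"
    using a \<open>a \<noteq> t\<close> b vel by (simp add: x y_def billiard_step_iff)
  have "z = y" if "fst x < fst z \<and> fst z < fst x + L \<and> billiard_step \<gamma> x z" for z
    using that y by (intro billiard_map_eqI[of x y z]) (simp_all add: billiard_step_iff)
  with y have "\<exists>!y. fst x < fst y \<and> fst y < fst x + L \<and> billiard_step \<gamma> x y" by blast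
  from theI'[OF this] show "fst x < fst (billiard_map \<gamma> L x)" "fst (billiard_map \<gamma> L x) < fst x + L"
    "billiard_step \<gamma> x (billiard_map \<gamma> L x)" unfolding billiard_map_def by auto
qed

lemma billiard_map_shift:
  assumes "x \<in> phase_space \<gamma>" and "x + (L, 0) \<in> phase_space \<gamma>"
  shows "billiard_map \<gamma> L (x + (L, 0)) = billiard_map \<gamma> L x + (L, 0)"
proof -
  define y where "y = billiard_map \<gamma> L x"
  have "velocity \<gamma> (t + L) = velocity \<gamma> t" for t by (rule velocity_eq[OF period])
  moreover have "fst x < fst y" "fst y < fst x + L" "billiard_step \<gamma> x y"
    unfolding y_def using billiard_map[OF assms(1)] by auto
  ultimately have "y + (L, 0) = billiard_map \<gamma> L (x + (L, 0))"
    using period by (intro billiard_map_eqI[OF billiard_map[OF assms(2)]])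
      (simp_all add: billiard_step_iff)
  then show ?thesis by (simp add: y_def)
qed

lemma consecI:
  assumes "x \<in> phase_space \<gamma>" and "billiard_map \<gamma> L x = y" and "y \<in> phase_space \<gamma>"
    and "billiard_map \<gamma> L y = z"
  shows "consec (fst x) (fst y) (fst z)"
  using billiard_map[OF assms(1)] billiard_map[OF assms(3)] unfolding assms(2,4)
  by (simp add: consec_def billiard_step_iff det2_diff_right det2_swap[of "velocity \<gamma> _" "\<gamma> _"])

text \<open>Successive impacts satisfy a closed relation, so the map \<open>g\<close> that the billiard map induces on the
  parameter of an invariant curve has a closed graph; being locally bounded, it is continuous.\<close>

lemma dynamics_continuous:
  fixes c :: "real \<Rightarrow> real \<times> real" and g :: "real \<Rightarrow> real"
  assumes c_cont: "continuous_on UNIV c" and "inj c" and c_shift: "\<And>u. c (u + 1) = c u + (L, 0)"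
    and phase: "range c \<subseteq> phase_space \<gamma>" and g: "\<And>u. billiard_map \<gamma> L (c u) = c (g u)"
  shows "continuous_on UNIV g"
proof -
  have cont: "continuous_on S c" for S using c_cont by (rule continuous_on_subset) simp
  have step: "fst (c u) < fst (c (g u))" "fst (c (g u)) < fst (c u) + L" "billiard_step \<gamma> (c u) (c (g u))" for u
    using billiard_map[of "c u"] phase unfolding g by auto
  define X where "X u = fst (c u)" for u
  have "continuous_on UNIV X" unfolding X_def by (intro continuous_intros cont)
  moreover have "X (u + 1) = X u + L" for u by (simp add: X_def c_shift)
  ultimately obtain M where M: "\<And>v. \<bar>X v - L * v\<bar> \<le> M" using shift_near_linear[of X L] by metis
  \<comment> \<open>A step advances the impact parameter by less than \<open>L\<close>, so \<open>g u - u\<close> is bounded and, locally,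
    the values of \<open>g\<close> lie in a compact set.\<close>
  have bound: "u - 2 * M / L \<le> g u" "g u \<le> u + 1 + 2 * M / L" for u
  proof -
    have "L * u - 2 * M \<le> L * g u" "L * g u \<le> L * u + L + 2 * M"
      using M[of u] M[of "g u"] step(1,2)[of u] unfolding X_def[symmetric] by linarith+
    then show "u - 2 * M / L \<le> g u" "g u \<le> u + 1 + 2 * M / L" using L_pos by (simp_all add: field_simps)
  qed
  have vel: "continuous_on S (\<lambda>x. velocity \<gamma> (f x))" if "continuous_on S f" for S and f :: "real \<times> real \<Rightarrow> real"
    using continuous_on_compose2[OF cont_deriv that] by simp
  have pos: "continuous_on S (\<lambda>x. \<gamma> (f x))" if "continuous_on S f" for S and f :: "real \<times> real \<Rightarrow> real"
    using continuous_on_compose2[OF curve_cont that] by blast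
  have curve: "continuous_on S (\<lambda>x. c (f x))" if "continuous_on S f" for S and f :: "real \<times> real \<Rightarrow> real"
    using continuous_on_compose2[OF c_cont that] by simp
  have "continuous_on {u - 1..u + 1} g" for u
  proof (rule continuous_from_closed_graph)
    let ?T = "{u - 1 - 2 * M / L..u + 2 + 2 * M / L}"
    show "compact ?T" by simp
    show "g \<in> {u - 1..u + 1} \<rightarrow> ?T"
    proof
      fix v assume "v \<in> {u - 1..u + 1}"
      then show "g v \<in> ?T" using bound[of v] by simp
    qed
    let ?W = "{p. fst (c (fst p)) \<le> fst (c (snd p)) \<and> fst (c (snd p)) \<le> fst (c (fst p)) + L \<and>
      0 \<le> det2 (velocity \<gamma> (fst (c (fst p)))) (velocity \<gamma> (fst (c (snd p)))) \<and>
      snd (c (fst p)) = - det2 (velocity \<gamma> (fst (c (fst p)))) (\<gamma> (fst (c (snd p)))) \<and>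
      snd (c (snd p)) = det2 (\<gamma> (fst (c (fst p)))) (velocity \<gamma> (fst (c (snd p))))}"
    have "(\<lambda>x. (x, g x)) ` {u - 1..u + 1} = ({u - 1..u + 1} \<times> UNIV) \<inter> ?W"
    proof (intro equalityI subsetI)
      fix p assume "p \<in> (\<lambda>x. (x, g x)) ` {u - 1..u + 1}"
      then obtain v where "p = (v, g v)" "v \<in> {u - 1..u + 1}" by blast
      then show "p \<in> ({u - 1..u + 1} \<times> UNIV) \<inter> ?W"
        using step[of v] by (simp add: billiard_step_iff)
    next
      fix p assume p: "p \<in> ({u - 1..u + 1} \<times> UNIV) \<inter> ?W"
      then have "c (snd p) = c (g (fst p))"
        by (intro billiard_map_eqI[OF step]) simp_all
      then have "snd p = g (fst p)" using \<open>inj c\<close> by (simp add: inj_eq)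
      then show "p \<in> (\<lambda>x. (x, g x)) ` {u - 1..u + 1}" using p by (cases p) auto
    qed
    moreover have "closed ?W"
      by (intro closed_Collect_conj closed_Collect_le closed_Collect_eq continuous_intros vel pos curve)
    ultimately show "closed ((\<lambda>x. (x, g x)) ` {u - 1..u + 1})"
      by (simp add: closed_Int closed_Times)
  qed
  then have "isCont g u" for u
    using continuous_on_interior[of "{u - 1..u + 1}" g u] by simp
  then show ?thesis by (simp add: continuous_on_eq_continuous_at)
qed

end

section \<open>Curves of periodic orbits in a symmetric table\<close>

lemma not_coprime_shorter_period:
  assumes "\<not> coprime m (int k)" and "k > 0"
  obtains j q where "0 < j" and "j < k" and "real j * (of_int m / real k) = of_int q"
proof -
  define d where "d = nat (gcd m (int k))"
  have d: "int d = gcd m (int k)" by (simp add: d_def)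
  have "d > 1"
    using assms d by (cases "d = 0 \<or> d = 1") (auto simp: coprime_iff_gcd_eq_1)
  have "int d dvd m" by (simp add: d)
  then obtain q where q: "m = int d * q" by (rule dvdE)
  have "int d dvd int k" by (simp add: d)
  then have "d dvd k" by (simp only: of_nat_dvd_iff)
  then obtain j where j: "k = d * j" by (rule dvdE)
  have "0 < j" "j < k" using j \<open>k > 0\<close> \<open>d > 1\<close> by auto
  moreover have "real j * (of_int m / real k) = of_int q"
    using \<open>d > 1\<close> \<open>0 < j\<close> by (simp add: q j field_simps)
  ultimately show thesis by (rule that)
qed

context billiard_table
begin

text \<open>The parameter of the invariant curve can be chosen so that the billiard map becomes a rational
  translation.  Minimality of the period makes the fraction irreducible.\<close>

lemma periodic_curve_translation:
  assumes C: "rotational_invariant_curve \<gamma> L C" and period: "\<And>x. x \<in> C \<Longrightarrow> minimal_period \<gamma> L x k"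
    and "k > 0"
  obtains X n where "periodic_invariant_circle consec L (of_int n / real k) X" and "coprime n (int k)"
proof -
  obtain c :: "real \<Rightarrow> real \<times> real" where c_cont: "continuous_on UNIV c" and "inj c"
      and c_shift: "\<And>u. c (u + 1) = c u + (L, 0)" and C_eq: "C = range c"
    using C unfolding rotational_invariant_curve_def rotational_curve_def by blast
  have phase: "\<And>u. c u \<in> phase_space \<gamma>" and invariant: "billiard_map \<gamma> L ` range c = range c"
    using C unfolding rotational_invariant_curve_def C_eq by auto
  have "\<exists>v. billiard_map \<gamma> L (c u) = c v" for u using invariant by blast
  then obtain g where g: "\<And>u. billiard_map \<gamma> L (c u) = c (g u)" by metis
  have c_int: "c (u + of_int j) = c u + (of_int j * L, 0)" for u j
    using shift_of_int[of c 1 "(L, 0)", OF c_shift, of u j] by simp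
  have g_cont: "continuous_on UNIV g"
    using c_cont \<open>inj c\<close> c_shift _ g by (rule dynamics_continuous) (use phase in blast)
  have g_shift: "g (u + 1) = g u + 1" for u
  proof -
    have "c u + (L, 0) \<in> phase_space \<gamma>" using phase[of "u + 1"] by (simp only: c_shift)
    from billiard_map_shift[OF phase this] have "c (g (u + 1)) = c (g u + 1)"
      by (simp only: g c_shift[symmetric])
    then show ?thesis using \<open>inj c\<close> by (simp add: inj_eq)
  qed
  have g_pow: "(billiard_map \<gamma> L ^^ j) (c u) = c ((g ^^ j) u)" for j u
    by (induction j) (simp_all add: g)
  have g_period: "(g ^^ k) u - u \<in> \<int>" for u
  proof -
    have "same_point L (c ((g ^^ k) u)) (c u)"
      using period[of "c u"] by (simp add: C_eq minimal_period_def g_pow)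
    then obtain j :: int where "c ((g ^^ k) u) = c (u + of_int j)"
      unfolding same_point_def c_int by blast
    then have "(g ^^ k) u = u + of_int j" using \<open>inj c\<close> by (simp add: inj_eq)
    then show ?thesis by simp
  qed
  obtain h n where h: "strict_mono h" "continuous_on UNIV h" "surj h" "\<And>u. h (u + 1) = h u + 1"
      and conj: "\<And>u. h (g u) = h u + of_int n / real k"
    by (rule conjugate_to_translation[of g, OF g_cont g_shift \<open>k > 0\<close> g_period]) (rule that)
  define e where "e = inv h"
  have he: "h (e w) = w" for w unfolding e_def using h(3) by (rule surj_f_inv_f)
  have eh: "e (h u) = u" for u
    unfolding e_def using strict_mono_imp_inj_on[OF h(1)] by (rule inv_f_f)
  have e_less: "e v < e w \<longleftrightarrow> v < w" for v w
    using strict_mono_less[OF h(1), of "e v" "e w"] by (simp add: he)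
  have "surj e" using eh by (rule surjI)
  then have e_cont: "continuous_on UNIV e"
    by (intro continuous_onI_mono) (auto simp: e_less not_less[symmetric])
  have e_int: "e (w + of_int j) = e w + of_int j" for w j
  proof -
    have "e (h (e w + of_int j)) = e (w + of_int j)"
      using shift_of_int[of h 1 1, OF h(4), of "e w" j] by (simp add: he)
    then show ?thesis by (simp add: eh)
  qed
  define \<theta> where "\<theta> = of_int n / real k"
  have ge: "g (e w) = e (w + \<theta>)" for w
    using eh[of "g (e w)"] by (simp add: conj he \<theta>_def)
  have step: "billiard_map \<gamma> L (c (e w)) = c (e (w + \<theta>))" for w by (simp only: g ge)
  define X where "X w = fst (c (e w))" for w
  have "periodic_invariant_circle consec L \<theta> X"
  proof
    show "0 < L" by (rule L_pos)
    show "continuous_on UNIV X" unfolding X_def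
      by (intro continuous_on_fst continuous_on_compose2[OF c_cont e_cont]) simp
    show "X (u + 1) = X u + L" for u using e_int[of u 1] by (simp add: X_def c_shift)
    show "consec (X (u - \<theta>)) (X u) (X (u + \<theta>))" for u
      unfolding X_def using step[of "u - \<theta>"] by (intro consecI phase step) simp
    show "consec x0 x1 x2 \<Longrightarrow> consec y0 x1 y2 \<Longrightarrow> x0 \<le> y0 \<Longrightarrow> x2 \<le> y2 \<Longrightarrow> x0 = y0 \<and> x2 = y2"
      for x0 x1 x2 y0 y2 by (rule consec_twist)
    show "u = v" if "X u = X v" "X (u + \<theta>) = X (v + \<theta>)" for u v
    proof -
      have "snd (c (e w)) = - det2 (velocity \<gamma> (X w)) (\<gamma> (X (w + \<theta>)))" for w
        using billiard_map(3)[OF phase[of "e w"]] by (simp add: step billiard_step_iff X_def)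
      then have "c (e u) = c (e v)" using that by (simp add: prod_eq_iff X_def)
      then have "e u = e v" using \<open>inj c\<close> by (simp add: inj_eq)
      then show ?thesis by (metis he)
    qed
  qed
  moreover have "coprime n (int k)"
  proof (rule ccontr)
    assume "\<not> coprime n (int k)"
    then obtain j q where j: "0 < j" "j < k" and q: "real j * \<theta> = of_int q"
      using not_coprime_shorter_period[OF _ \<open>k > 0\<close>] unfolding \<theta>_def by metis
    have pow: "(billiard_map \<gamma> L ^^ i) (c (e 0)) = c (e (of_nat i * \<theta>))" for i
      by (induction i) (simp_all add: step algebra_simps)
    have "(billiard_map \<gamma> L ^^ j) (c (e 0)) = c (e 0) + (of_int q * L, 0)"
      using pow[of j] e_int[of 0 q] by (simp add: q c_int)
    then have "same_point L ((billiard_map \<gamma> L ^^ j) (c (e 0))) (c (e 0))"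
      unfolding same_point_def by blast
    then show False using j period[of "c (e 0)"] by (auto simp: C_eq minimal_period_def)
  qed
  ultimately show thesis using that unfolding \<theta>_def by blast
qed

end

lemma linear_fixing_basis:
  assumes "linear B" and "B u = u" "B v = v" and "det2 u v \<noteq> 0"
  shows "B = id"
proof
  fix w :: "real^2"
  have "det2 u v *\<^sub>R w = det2 w v *\<^sub>R u + det2 u w *\<^sub>R v"
    by (simp add: vec_eq_iff forall_2 det2_eq algebra_simps)
  then have w: "w = (1 / det2 u v) *\<^sub>R (det2 w v *\<^sub>R u + det2 u w *\<^sub>R v)"
    using assms(4) by (metis scaleR_scaleR divide_self_if scaleR_one times_divide_eq_left mult_1)
  have "B ((1 / det2 u v) *\<^sub>R (det2 w v *\<^sub>R u + det2 u w *\<^sub>R v))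
      = (1 / det2 u v) *\<^sub>R (det2 w v *\<^sub>R u + det2 u w *\<^sub>R v)"
    by (simp only: linear_add[OF assms(1)] linear_scale[OF assms(1)] assms(2,3))
  then show "B w = id w" using w by simp
qed

locale symmetric_table = billiard_table \<gamma> L + finite_order_map A k for \<gamma> L A k +
  assumes invariant: "A ` range \<gamma> = range \<gamma>"
    and minimal: "\<And>j. 0 < j \<Longrightarrow> j < k \<Longrightarrow> A ^^ j \<noteq> id"
    and k_ge_3: "k \<ge> 3"
begin

lemma A_not_involution: "A \<circ> A \<noteq> id"
  using minimal[of 2] k_ge_3 by (simp add: numeral_2_eq_2 o_def id_def fun_eq_iff)

lemma area_preserving: "det2 (A u) (A v) = det2 u v"
  using A_not_involution by (rule det_one)

text \<open>Since both the symmetry and the dynamics are translations by multiples of \<open>1 / k\<close> with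
  numerator coprime to \<open>k\<close>, the billiard orbits are orbits of a power of the symmetry.\<close>

lemma dynamics_is_symmetry:
  assumes X: "periodic_invariant_circle consec L (of_int n / real k) X" and n: "coprime n (int k)"
  obtains j where "\<And>u. \<gamma> (X (u + of_int n / real k)) = (A ^^ j) (\<gamma> (X u))"
proof -
  interpret periodic_invariant_circle consec L "of_int n / real k" X by (rule X)
  obtain \<rho> where \<rho>: "strict_mono \<rho>" "\<And>t. \<rho> (t + L) = \<rho> t + L" "\<And>t. \<gamma> (\<rho> t) = A (\<gamma> t)"
    using linear_symmetry_lift[OF lin inj_A invariant area_preserving] by blast
  have "\<gamma> ((\<rho> ^^ i) t) = (A ^^ i) (\<gamma> t)" for i t by (induction i) (simp_all add: \<rho>(3))
  then have "\<exists>j::int. (\<rho> ^^ k) t = t + of_int j * L" for t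
    using curve_eq_iff[of "(\<rho> ^^ k) t" t] by (simp add: order)
  moreover have "consec (\<rho> x0) (\<rho> x1) (\<rho> x2)" if "consec x0 x1 x2" for x0 x1 x2
    using linear_symmetry_consec[OF lin inj_A area_preserving \<rho> invariant that] .
  ultimately obtain m :: int where m: "\<And>u. \<rho> (X u) = X (u + of_int m / k)"
    using symmetry_is_translation[OF \<rho>(1,2) _ _ k_pos refl n] by blast
  have pow: "(A ^^ i) (\<gamma> (X u)) = \<gamma> (X (u + of_nat i * of_int m / k))" for i u
  proof (induction i)
    case (Suc i)
    have "(A ^^ Suc i) (\<gamma> (X u)) = \<gamma> (\<rho> (X (u + of_nat i * of_int m / k)))"
      by (simp add: Suc \<rho>(3))
    then show ?case by (simp add: m add_divide_distrib algebra_simps)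
  qed simp
  have curve_int: "\<gamma> (X (u + of_int j)) = \<gamma> (X u)" for u j
    by (simp add: shift_int period_int)
  have "coprime m (int k)"
  proof (rule ccontr)
    assume "\<not> coprime m (int k)"
    then obtain j q where j: "0 < j" "j < k" and "real j * (of_int m / real k) = of_int q"
      by (rule not_coprime_shorter_period[OF _ k_pos])
    then have "(A ^^ j) (\<gamma> (X u)) = \<gamma> (X u)" for u using pow[of j u] curve_int[of u q] by simp
    then have fixes_curve: "(A ^^ j) (\<gamma> t) = \<gamma> t" for t using X_surj by (metis surjD)
    have "A ^^ j = id"
    proof (rule linear_fixing_basis[OF linear_power])
      show "det2 (\<gamma> (L / 3) - \<gamma> 0) (\<gamma> (L / 2) - \<gamma> 0) \<noteq> 0"
        using chord_turns_left[of 0 "L / 3" "L / 2"] L_pos by simp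
    qed (simp_all add: linear_diff[OF linear_power] fixes_curve)
    then show False using minimal[OF j] by blast
  qed
  \<comment> \<open>As \<open>m\<close> is invertible modulo \<open>k\<close>, some \<open>j\<close> satisfies \<open>j * m = n\<close> modulo \<open>k\<close>.\<close>
  then obtain a b where ab: "a * m + b * int k = 1"
    using bezout_int[of m "int k"] by (auto simp: coprime_iff_gcd_eq_1)
  define j where "j = nat ((a * n) mod int k)"
  have "int j = a * n - int k * (a * n div int k)"
    using k_pos by (simp add: j_def minus_mult_div_eq_mod)
  then have "int j * m = n + int k * (- n * b - m * (a * n div int k))"
    using ab by algebra
  then obtain z where "int j * m = n + int k * z" by blast
  then have "real j * of_int m = of_int n + real k * of_int z"
    by (metis of_int_add of_int_mult of_int_of_nat_eq)
  then have z: "of_nat j * of_int m / real k = of_int n / k + of_int z"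
    using k_pos by (simp add: field_simps)
  have "\<gamma> (X (u + of_int n / k)) = (A ^^ j) (\<gamma> (X u))" for u
    unfolding pow z add.assoc[symmetric] curve_int ..
  then show thesis by (rule that)
qed

text \<open>If \<open>B\<close> moves each point of an orbit to the next one, then the tangent at \<open>p\<close> is parallel to
  \<open>B p - B\<^sup>-\<^sup>1 p\<close>, and this vector is orthogonal to \<open>p\<close> for the \<open>B\<close>-invariant inner product.\<close>

lemma tangent_orthogonal:
  assumes orbit: "consec x0 x1 x2"
    and B: "\<gamma> x1 = (A ^^ j) (\<gamma> x0)" "\<gamma> x2 = (A ^^ j) (\<gamma> x1)"
  shows "orbit_inner (\<gamma> x1) (velocity \<gamma> x1) = 0"
proof -
  have "\<gamma> x2 \<noteq> \<gamma> x0"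
  proof
    assume "\<gamma> x2 = \<gamma> x0"
    then have "velocity \<gamma> x2 = velocity \<gamma> x0" by (rule velocity_eq)
    then show False using orbit det2_swap[of "velocity \<gamma> x0" "velocity \<gamma> x1"] by (auto simp: consec_def)
  qed
  have "det2 (velocity \<gamma> x1) (\<gamma> x2 - \<gamma> x0) = 0" using orbit by (simp add: consec_def)
  then obtain r where r: "\<gamma> x2 - \<gamma> x0 = r *\<^sub>R velocity \<gamma> x1"
    using det2_zero_imp_parallel velocity_nonzero by blast
  have "orbit_inner (\<gamma> x1) (\<gamma> x2) = orbit_inner (\<gamma> x0) (\<gamma> x1)"
    using orbit_inner_invariant_power[of j "\<gamma> x0" "\<gamma> x1"] by (simp only: B[symmetric])
  then have "orbit_inner (\<gamma> x1) (\<gamma> x2 - \<gamma> x0) = 0" by (simp add: orbit_inner_diff_right orbit_inner_commute)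
  then have "r * orbit_inner (\<gamma> x1) (velocity \<gamma> x1) = 0" by (simp only: r orbit_inner_scaleR_right)
  moreover have "r \<noteq> 0" using r \<open>\<gamma> x2 \<noteq> \<gamma> x0\<close> by auto
  ultimately show ?thesis by simp
qed

lemma curve_in_ellipse:
  assumes C: "rotational_invariant_curve \<gamma> L C" and period: "\<And>x. x \<in> C \<Longrightarrow> minimal_period \<gamma> L x k"
  obtains c where "c > 0" and "range \<gamma> \<subseteq> {v. orbit_inner v v = c}"
proof -
  obtain X n where X: "periodic_invariant_circle consec L (of_int n / real k) X" and n: "coprime n (int k)"
    using periodic_curve_translation[OF C period k_pos] by blast
  interpret periodic_invariant_circle consec L "of_int n / real k" X by (rule X)
  obtain j where j: "\<And>u. \<gamma> (X (u + of_int n / real k)) = (A ^^ j) (\<gamma> (X u))"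
    using dynamics_is_symmetry[OF X n] by blast
  have "orbit_inner (\<gamma> (X u)) (velocity \<gamma> (X u)) = 0" for u
    using tangent_orthogonal[OF orbit[of u], of j] j[of u] j[of "u - of_int n / real k"] by simp
  then have "orbit_inner (\<gamma> t) (velocity \<gamma> t) = 0" for t using X_surj by (metis surjD)
  then have "((\<lambda>t. orbit_inner (\<gamma> t) (\<gamma> t)) has_real_derivative 0) (at t)" for t
    using orbit_inner_has_derivative[OF deriv, of t] by simp
  then have const: "orbit_inner (\<gamma> t) (\<gamma> t) = orbit_inner (\<gamma> 0) (\<gamma> 0)" for t by (intro DERIV_isconst_all) auto
  have "\<gamma> 0 \<noteq> 0"
  proof
    assume "\<gamma> 0 = 0"
    then have "\<gamma> t = 0" for t using const[of t] orbit_inner_eq_0[of "\<gamma> t"] orbit_inner_zero by simp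
    then show False using curve_neq[of 0 "L / 2"] L_pos by simp
  qed
  then show thesis using that[OF orbit_inner_pos] const by blast
qed

text \<open>The barycentre of an orbit of an interior point is an interior point fixed by the symmetry, and only
  the origin is fixed.\<close>

lemma origin_in_interior:
  assumes "interior (convex hull range \<gamma>) \<noteq> {}"
  shows "0 \<in> interior (convex hull range \<gamma>)"
proof -
  let ?I = "interior (convex hull range \<gamma>)"
  have "A ` (convex hull range \<gamma>) = convex hull range \<gamma>"
    using convex_hull_linear_image[OF lin, of "range \<gamma>"] invariant by simp
  then have I: "A ` ?I = ?I"
    using interior_injective_linear_image[OF lin inj_A, of "convex hull range \<gamma>"] by simp
  obtain p where p: "p \<in> ?I" using assms by blast
  have orbit: "(A ^^ i) p \<in> ?I" for i by (induction i) (use p I in auto)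
  define q where "q = (\<Sum>i<k. (1 / real k) *\<^sub>R (A ^^ i) p)"
  have "q \<in> ?I" unfolding q_def
    using orbit k_pos by (intro convex_sum) (auto simp: convex_interior)
  define F where "F i = (1 / real k) *\<^sub>R (A ^^ i) p" for i
  have "A q = (\<Sum>i<k. F (Suc i))"
    by (simp add: q_def F_def linear_sum[OF lin] linear_scale[OF lin])
  also have "\<dots> = (\<Sum>i<k. F i) + F k - F 0"
    using sum.lessThan_Suc_shift[of F k] sum.lessThan_Suc[of F k] by (simp add: algebra_simps)
  also have "\<dots> = q" by (simp add: q_def F_def order)
  finally have "q = 0" using no_fixed_vector[OF A_not_involution] by blast
  then show ?thesis using \<open>q \<in> ?I\<close> by simp
qed

lemma range_compact: "compact (range \<gamma>)"
proof -
  have "range \<gamma> = \<gamma> ` {0..L}"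
  proof -
    have "\<gamma> t \<in> \<gamma> ` {0..L}" for t
    proof -
      obtain s where "s \<in> {0..<0 + L}" "\<gamma> s = \<gamma> t" using representative by blast
      then have "\<gamma> t = \<gamma> s" "s \<in> {0..L}" by simp_all
      then show ?thesis by (rule image_eqI)
    qed
    then show ?thesis by auto
  qed
  then show ?thesis using compact_continuous_image[OF curve_cont, of "{0..L}"] by simp
qed

text \<open>Each ray from the origin leaves the enclosed region at a point of the curve, and it meets the
  level set only once, so the curve cannot miss a point of the ellipse.\<close>

lemma range_is_ellipse:
  assumes boundary: "range \<gamma> = frontier (convex hull range \<gamma>)"
    and interior: "interior (convex hull range \<gamma>) \<noteq> {}"
    and c: "c > 0" "range \<gamma> \<subseteq> {v. orbit_inner v v = c}"
  shows "ellipse (range \<gamma>)"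
proof -
  have "{v. orbit_inner v v = c} \<subseteq> range \<gamma>"
  proof
    fix v assume v: "v \<in> {v. orbit_inner v v = c}"
    then have "v \<noteq> 0" using c(1) orbit_inner_zero by auto
    have "bounded (convex hull range \<gamma>)"
      using range_compact by (intro bounded_convex_hull compact_imp_bounded)
    then obtain s where s: "0 < s" "0 + s *\<^sub>R v \<in> frontier (convex hull range \<gamma>)"
      using ray_to_frontier[OF _ origin_in_interior[OF interior] \<open>v \<noteq> 0\<close>] by blast
    then have sv: "s *\<^sub>R v \<in> range \<gamma>" using boundary by simp
    then have "orbit_inner (s *\<^sub>R v) (s *\<^sub>R v) = c" using c(2) by blast
    then have "s\<^sup>2 = 1\<^sup>2" using v c(1) by (simp add: orbit_inner_scaleR_left orbit_inner_scaleR_right power2_eq_square)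
    then have "s = 1" using s(1) by (intro power2_eq_imp_eq[of s 1]) simp_all
    then show "v \<in> range \<gamma>" using sv by simp
  qed
  with c(2) have "range \<gamma> = {v. orbit_inner v v = c}" by blast
  then show ?thesis using ellipse_orbit_inner_level[OF c(1)] by simp
qed

end

text \<open>The midpoint of a chord is an interior point, hence to the left of every tangent, and it lies
  on the same side of the tangent at one end of the chord as the other end does.\<close>

lemma billiard_tableI:
  assumes curve: "simple_closed_C2_curve \<gamma> L" and convex: "strictly_convex_curve (range \<gamma>)"
    and orient: "positively_oriented \<gamma>"
  shows "billiard_table \<gamma> L"
proof
  show "0 < L" "\<gamma> (t + L) = \<gamma> t" "inj_on \<gamma> {0..<L}" for t
    using curve by (auto simp: simple_closed_C2_curve_def)
  have "\<gamma> C1_differentiable_on UNIV" using curve by (simp add: simple_closed_C2_curve_def)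
  then show "(\<gamma> has_vector_derivative velocity \<gamma> t) (at t)" "continuous_on UNIV (velocity \<gamma>)" for t
    by (auto simp: C1_differentiable_on_eq vector_derivative_works)
  fix a b assume ab: "\<gamma> a \<noteq> \<gamma> b"
  have "midpoint (\<gamma> a) (\<gamma> b) \<in> open_segment (\<gamma> a) (\<gamma> b)" using ab by simp
  then have "midpoint (\<gamma> a) (\<gamma> b) \<in> interior (convex hull range \<gamma>)"
    using convex ab unfolding strictly_convex_curve_def by blast
  then have "0 < det2 (velocity \<gamma> a) (midpoint (\<gamma> a) (\<gamma> b) - \<gamma> a)"
    using orient unfolding positively_oriented_def by blast
  moreover have "midpoint (\<gamma> a) (\<gamma> b) - \<gamma> a = (1 / 2) *\<^sub>R (\<gamma> b - \<gamma> a)"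
    by (simp add: midpoint_def vec_eq_iff field_simps)
  ultimately show "0 < det2 (velocity \<gamma> a) (\<gamma> b - \<gamma> a)" by (simp only: det2_scaleR_right)
qed

theorem theorem3:
  fixes k :: nat and \<gamma> :: "real \<Rightarrow> real^2" and L :: real and A :: "real^2 \<Rightarrow> real^2"
  assumes "k \<ge> 3"
    and "simple_closed_C2_curve \<gamma> L"
    and "strictly_convex_curve (range \<gamma>)"
    and "positively_oriented \<gamma>"
    and "linear A" and "map_order A k" and "A ` range \<gamma> = range \<gamma>"
    and "\<exists>C. rotational_invariant_curve \<gamma> L C \<and> (\<forall>x\<in>C. minimal_period \<gamma> L x k)"
  shows "ellipse (range \<gamma>)"
proof -
  interpret billiard_table \<gamma> L using assms(2-4) by (rule billiard_tableI)
  interpret symmetric_table \<gamma> L A k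
  proof (intro symmetric_table.intro finite_order_map.intro symmetric_table_axioms.intro)
    show "billiard_table \<gamma> L" by (rule billiard_table_axioms)
    show "linear A" "A ` range \<gamma> = range \<gamma>" "3 \<le> k" by fact+
    show "0 < k" "A ^^ k = id" using assms(6) by (simp_all add: map_order_def)
    show "A ^^ j \<noteq> id" if "0 < j" "j < k" for j
      using assms(6) that unfolding map_order_def by blast
  qed
  obtain C where "rotational_invariant_curve \<gamma> L C" "\<And>x. x \<in> C \<Longrightarrow> minimal_period \<gamma> L x k"
    using assms(8) by blast
  then obtain c where c: "c > 0" "range \<gamma> \<subseteq> {v. orbit_inner v v = c}" using curve_in_ellipse by blast
  have boundary: "range \<gamma> = frontier (convex hull range \<gamma>)"
    using assms(3) by (simp add: strictly_convex_curve_def)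
  have "\<gamma> 0 \<noteq> \<gamma> (L / 2)" using curve_neq[of 0 "L / 2"] L_pos by simp
  then have "open_segment (\<gamma> 0) (\<gamma> (L / 2)) \<subseteq> interior (convex hull range \<gamma>)"
    "open_segment (\<gamma> 0) (\<gamma> (L / 2)) \<noteq> {}"
    using assms(3) by (auto simp: strictly_convex_curve_def)
  then have "interior (convex hull range \<gamma>) \<noteq> {}" by blast
  from range_is_ellipse[OF boundary this c] show ?thesis .
qed

end
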